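(* Fix $0<\alpha<\frac12$ and define $$\mathcal T'=\min\Big\{T\in\mathbb N:\ \min_{0<t<T}\ \max_{I\subset[n]:\ \pi(\cup_{i\in I}\Omega_i)\ge\frac\alpha2}\Big(\max_{z\in\Omega}\mathbb P_z\Big[\bigcap_{i\in I}\{\kappa_i(T)<t\}\Big]+\sum_{i\in I}e^{-\big\lfloor\frac{c'_{\alpha/2}\,t}{e\,\varphi_i}\big\rfloor}\Big)<\frac14\Big\}.$$ Then the mixing time $\tau_{\mathrm{mix}}$ of $\{X_t\}_{t\in\mathbb N}$ satisfies $$\tau_{\mathrm{mix}}\le\frac43\,c_\alpha\,\mathcal T'.$$
   Context: $\mathbb N=\{0,1,2,\dots\}$, $[n]=\{1,\dots,n\}$. $\{X_t\}_{t\in\mathbb N}$ is an irreducible, reversible, $\frac12$-lazy (i.e. $K(x,x)\ge\frac12$ for all $x$) Markov chain with kernel $K$ and stationary distribution $\pi$ on a finite state space $\Omega$ with $|\Omega|\ge2$. $\mathbb P_z,\mathbb E_z$ refer to the chain started at $X_0=z$. The mixing time of a Markov chain is the smallest $t>0$ such that $\max_x\|\mathcal L(X_t\mid X_0=x)-\pi\|_{\mathrm{TV}}<\frac14$, where $\|\mu-\nu\|_{\mathrm{TV}}=\max_A(\mu(A)-\nu(A))$. $\Omega=\bigsqcup_{i=1}^n\Omega_i$ is a partition into $n$ nonempty parts. The trace of the chain on $\Omega_i$ is the Markov chain on $\Omega_i$ obtained by observing $X_t$ only at its successive visits to $\Omega_i$; its kernel is $K_i(x,y)=\mathbb P_x[X_{\sigma}=y]$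 with $\sigma=\min\{t\ge1:X_t\in\Omega_i\}$. $\varphi_i$ is the mixing time of $K_i$. The occupation time $\kappa_i(s)$ is the number of times $u\in\{0,1,\dots,s\}$ with $X_u\in\Omega_i$. Constants: for $0<\alpha<\frac12$, $c_\alpha,c'_\alpha>0$ denote universal constants (which exist by known results of Peres--Sousi and Oliveira) such that for every irreducible, $\frac12$-lazy, reversible Markov chain on a finite state space with at least two points, with stationary distribution $\pi$ and mixing time $\tau_{\mathrm{mix}}$, $$c'_\alpha\max_{z,\,A:\pi(A)\ge\alpha}\mathbb E_z[\tau_A]\le\tau_{\mathrm{mix}}\le c_\alpha\max_{z,\,A:\pi(A)\ge\alpha}\mathbb E_z[\tau_A],\qquad \tau_A=\min\{t\ge0:X_t\in A\}.$$ *)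

theory Defs
  imports "HOL-Probability.Probability"
begin

text \<open>
  A Markov chain lives on a finite carrier set \<open>V\<close>; only the values \<open>K x y\<close> with
  \<open>x, y \<in> V\<close> of its kernel matter. Probability vectors on \<open>V\<close> vanish outside \<open>V\<close>, which
  makes the stationary distribution unique as a function.
\<close>

definition stochastic :: "'a set \<Rightarrow> ('a \<Rightarrow> 'a \<Rightarrow> real) \<Rightarrow> bool" where
  "stochastic V K \<longleftrightarrow> (\<forall>x\<in>V. (\<forall>y\<in>V. 0 \<le> K x y) \<and> (\<Sum>y\<in>V. K x y) = 1)"

definition stationary :: "'a set \<Rightarrow> ('a \<Rightarrow> 'a \<Rightarrow> real) \<Rightarrow> ('a \<Rightarrow> real) \<Rightarrow> bool" where
  "stationary V K \<pi> \<longleftrightarrow>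
     (\<forall>x\<in>V. 0 \<le> \<pi> x) \<and> (\<forall>x. x \<notin> V \<longrightarrow> \<pi> x = 0) \<and> (\<Sum>x\<in>V. \<pi> x) = 1 \<and>
     (\<forall>y\<in>V. (\<Sum>x\<in>V. \<pi> x * K x y) = \<pi> y)"

definition stationary_dist :: "'a set \<Rightarrow> ('a \<Rightarrow> 'a \<Rightarrow> real) \<Rightarrow> 'a \<Rightarrow> real" where
  "stationary_dist V K = (THE \<pi>. stationary V K \<pi>)"

text \<open>
  The law of the whole trajectory of the chain started at \<open>z\<close>, on the product space
  \<open>\<Pi>\<^sub>M t\<in>UNIV. count_space V\<close>, is the Ionescu-Tulcea limit of the one-step transition kernels
  below (\<open>\<omega> t\<close> is the state \<open>X\<^sub>t\<close>); see \<open>emeasure_chain_law_cylinder\<close>.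
\<close>

definition chain_step ::
    "'a set \<Rightarrow> ('a \<Rightarrow> 'a \<Rightarrow> real) \<Rightarrow> 'a \<Rightarrow> nat \<Rightarrow> (nat \<Rightarrow> 'a) \<Rightarrow> 'a measure" where
  "chain_step V K z t \<omega> =
     (if t = 0 then return (count_space V) z
      else point_measure V (\<lambda>y. ennreal (K (\<omega> (t - 1)) y)))"

definition chain_law :: "'a set \<Rightarrow> ('a \<Rightarrow> 'a \<Rightarrow> real) \<Rightarrow> 'a \<Rightarrow> (nat \<Rightarrow> 'a) measure" where
  "chain_law V K z =
     projective_family.lim UNIV
       (Ionescu_Tulcea.CI (chain_step V K z) (\<lambda>_. count_space V)) (\<lambda>_. count_space V)"

definition chain_prob ::
    "'a set \<Rightarrow> ('a \<Rightarrow> 'a \<Rightarrow> real) \<Rightarrow> 'a \<Rightarrow> ((nat \<Rightarrow> 'a) \<Rightarrow> bool) \<Rightarrow> real" where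
  "chain_prob V K z E = measure (chain_law V K z) {\<omega> \<in> space (chain_law V K z). E \<omega>}"

definition irreducible_chain :: "'a set \<Rightarrow> ('a \<Rightarrow> 'a \<Rightarrow> real) \<Rightarrow> bool" where
  "irreducible_chain V K \<longleftrightarrow> (\<forall>x\<in>V. \<forall>y\<in>V. \<exists>t. chain_prob V K x (\<lambda>\<omega>. \<omega> t = y) > 0)"

definition lazy_reversible_chain ::
    "'a set \<Rightarrow> ('a \<Rightarrow> 'a \<Rightarrow> real) \<Rightarrow> ('a \<Rightarrow> real) \<Rightarrow> bool" where
  "lazy_reversible_chain V K \<pi> \<longleftrightarrow>
     finite V \<and> stochastic V K \<and> irreducible_chain V K \<and> stationary V K \<pi> \<and>
     (\<forall>x\<in>V. \<forall>y\<in>V. \<pi> x * K x y = \<pi> y * K y x) \<and>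
     (\<forall>x\<in>V. K x x \<ge> 1 / 2)"

definition tv_dist :: "'a set \<Rightarrow> ('a \<Rightarrow> real) \<Rightarrow> ('a \<Rightarrow> real) \<Rightarrow> real" where
  "tv_dist V \<mu> \<nu> = Max ((\<lambda>A. (\<Sum>x\<in>A. \<mu> x) - (\<Sum>x\<in>A. \<nu> x)) ` Pow V)"

definition mixing_time :: "'a set \<Rightarrow> ('a \<Rightarrow> 'a \<Rightarrow> real) \<Rightarrow> nat" where
  "mixing_time V K =
     (LEAST t. t > 0 \<and>
        Max ((\<lambda>x. tv_dist V (\<lambda>y. chain_prob V K x (\<lambda>\<omega>. \<omega> t = y)) (stationary_dist V K)) ` V)
          < 1 / 4)"

definition hitting_time :: "'a set \<Rightarrow> (nat \<Rightarrow> 'a) \<Rightarrow> ennreal" where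
  "hitting_time A \<omega> = (INF t\<in>{t. \<omega> t \<in> A}. of_nat t)"  \<comment> \<open>\<open>\<infinity>\<close> if \<open>A\<close> is never hit\<close>

definition expected_hitting_time ::
    "'a set \<Rightarrow> ('a \<Rightarrow> 'a \<Rightarrow> real) \<Rightarrow> 'a \<Rightarrow> 'a set \<Rightarrow> ennreal" where
  "expected_hitting_time V K z A = (\<integral>\<^sup>+ \<omega>. hitting_time A \<omega> \<partial>chain_law V K z)"

definition max_hitting_time ::
    "'a set \<Rightarrow> ('a \<Rightarrow> 'a \<Rightarrow> real) \<Rightarrow> ('a \<Rightarrow> real) \<Rightarrow> real \<Rightarrow> ennreal" where
  "max_hitting_time V K \<pi> \<alpha> =
     Max {expected_hitting_time V K z A | z A. z \<in> V \<and> A \<subseteq> V \<and> (\<Sum>x\<in>A. \<pi> x) \<ge> \<alpha>}"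

text \<open>
  \<open>c\<close> and \<open>c'\<close> are admissible universal constants at level \<open>\<alpha>\<close>. Every finite chain is
  isomorphic to one whose states are natural numbers, so quantifying over finite sets of
  natural numbers covers all finite state spaces.
\<close>

definition mixing_hitting_constants :: "real \<Rightarrow> real \<Rightarrow> real \<Rightarrow> bool" where
  "mixing_hitting_constants \<alpha> c c' \<longleftrightarrow>
     0 < c \<and> 0 < c' \<and>
     (\<forall>(V :: nat set) K \<pi>. lazy_reversible_chain V K \<pi> \<and> card V \<ge> 2 \<longrightarrow>
        ennreal c' * max_hitting_time V K \<pi> \<alpha> \<le> of_nat (mixing_time V K) \<and>
        of_nat (mixing_time V K) \<le> ennreal c * max_hitting_time V K \<pi> \<alpha>)"

text \<open>
  Kernel of the trace on \<open>S\<close>: the law of the state at the first time \<open>\<sigma> \<ge> 1\<close> in \<open>S\<close>. The first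
  conjunct excludes the (null) event that \<open>S\<close> is never revisited.
\<close>

definition trace_kernel :: "'a set \<Rightarrow> ('a \<Rightarrow> 'a \<Rightarrow> real) \<Rightarrow> 'a set \<Rightarrow> 'a \<Rightarrow> 'a \<Rightarrow> real" where
  "trace_kernel V K S x y =
     chain_prob V K x (\<lambda>\<omega>. (\<exists>t\<ge>1. \<omega> t \<in> S) \<and> \<omega> (LEAST t. t \<ge> 1 \<and> \<omega> t \<in> S) = y)"

definition occupation_time :: "'a set \<Rightarrow> nat \<Rightarrow> (nat \<Rightarrow> 'a) \<Rightarrow> nat" where
  "occupation_time S s \<omega> = card {u \<in> {0..s}. \<omega> u \<in> S}"

definition is_partition :: "'a set \<Rightarrow> nat \<Rightarrow> (nat \<Rightarrow> 'a set) \<Rightarrow> bool" where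
  "is_partition V n P \<longleftrightarrow>
     (\<Union>i\<in>{1..n}. P i) = V \<and> disjoint_family_on P {1..n} \<and> (\<forall>i\<in>{1..n}. P i \<noteq> {})"

text \<open>
  The time scale \<open>\<T>'\<close>; here \<open>c'\<close> stands for the constant \<open>c'\<close> at level \<open>\<alpha>/2\<close>. Since a minimum
  over no \<open>t\<close> at all is \<open>\<infinity>\<close> rather than a real number, only \<open>T\<close> with some \<open>0 < t < T\<close> qualify.
\<close>

definition occupation_bound ::
    "'a set \<Rightarrow> ('a \<Rightarrow> 'a \<Rightarrow> real) \<Rightarrow> (nat \<Rightarrow> 'a set) \<Rightarrow> real \<Rightarrow> nat \<Rightarrow> nat \<Rightarrow> nat set \<Rightarrow> real" where
  "occupation_bound V K P c' T t I =
     Max ((\<lambda>z. chain_prob V K z (\<lambda>\<omega>. \<forall>i\<in>I. occupation_time (P i) T \<omega> < t)) ` V) +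
     (\<Sum>i\<in>I. exp (- real_of_int
        \<lfloor>c' * real t / (exp 1 * real (mixing_time (P i) (trace_kernel V K (P i))))\<rfloor>))"

definition T_prime ::
    "'a set \<Rightarrow> ('a \<Rightarrow> 'a \<Rightarrow> real) \<Rightarrow> ('a \<Rightarrow> real) \<Rightarrow> nat \<Rightarrow> (nat \<Rightarrow> 'a set) \<Rightarrow> real \<Rightarrow> real \<Rightarrow> nat"
  where
  "T_prime V K \<pi> n P \<alpha> c' =
     (LEAST T. {0<..<T} \<noteq> {} \<and>
        Min ((\<lambda>t. Max (occupation_bound V K P c' T t `
               {I. I \<subseteq> {1..n} \<and> (\<Sum>x\<in>(\<Union>i\<in>I. P i). \<pi> x) \<ge> \<alpha> / 2})) ` {0<..<T}) < 1 / 4)"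

subsection \<open>The trajectory law is the intended one\<close>

lemma Ionescu_Tulcea_chain_step:
  assumes "finite V" "stochastic V K" "z \<in> V"
  shows "Ionescu_Tulcea (chain_step V K z) (\<lambda>_. count_space V)"
proof (rule Ionescu_Tulcea.intro)
  have ps: "prob_space (point_measure V (\<lambda>y. ennreal (K x y)))" if "x \<in> V" for x
  proof (rule prob_spaceI)
    have "emeasure (point_measure V (\<lambda>y. ennreal (K x y))) V = (\<Sum>y\<in>V. ennreal (K x y))"
      using assms(1) by (simp add: emeasure_point_measure_finite)
    also have "\<dots> = ennreal (\<Sum>y\<in>V. K x y)"
      using assms(2) that by (intro sum_ennreal) (auto simp: stochastic_def)
    also have "\<dots> = 1"
      using assms(2) that by (simp add: stochastic_def)
    finally show "emeasure (point_measure V (\<lambda>y. ennreal (K x y)))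
        (space (point_measure V (\<lambda>y. ennreal (K x y)))) = 1"
      by (simp add: space_point_measure)
  qed
  show "prob_space (chain_step V K z i x)"
    if "x \<in> space (PiM {0..<i} (\<lambda>_. count_space V))" for i x
    using that assms(3)
    by (cases i) (auto simp: chain_step_def space_PiM PiE_iff intro!: prob_space_return ps)
  have "(\<lambda>\<omega>. point_measure V (\<lambda>y. ennreal (K (\<omega> j) y)))
      \<in> measurable (PiM {0..<Suc j} (\<lambda>_. count_space V)) (subprob_algebra (count_space V))" for j
  proof (rule measurable_compose[OF measurable_component_singleton[of j]])
    show "(\<lambda>x. point_measure V (\<lambda>y. ennreal (K x y)))
      \<in> measurable (count_space V) (subprob_algebra (count_space V))"
      using ps by (auto simp: space_subprob_algebra sets_point_measure
          intro!: prob_space_imp_subprob_space)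
  qed simp
  moreover have "(\<lambda>_. return (count_space V) z)
      \<in> measurable (PiM {} (\<lambda>_. count_space V)) (subprob_algebra (count_space V))"
    using assms(3) by (intro measurable_const)
      (auto simp: space_subprob_algebra intro!: prob_space_imp_subprob_space prob_space_return)
  ultimately show "chain_step V K z i \<in>
      measurable (PiM {0..<i} (\<lambda>_. count_space V)) (subprob_algebra (count_space V))" for i
    unfolding chain_step_def[abs_def] by (cases i) simp_all
qed

lemma emeasure_chain_law_cylinder:
  assumes "finite V" "stochastic V K" "z \<in> V" and x: "\<And>i. i \<le> m \<Longrightarrow> x i \<in> V"
  shows "emeasure (chain_law V K z) {\<omega> \<in> space (chain_law V K z). \<forall>i\<le>m. \<omega> i = x i} =
    ennreal (of_bool (x 0 = z) * (\<Prod>i<m. K (x i) (x (Suc i))))"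
proof -
  interpret IT: Ionescu_Tulcea "chain_step V K z" "\<lambda>_. count_space V"
    using assms by (intro Ionescu_Tulcea_chain_step)
  define S where "S = (\<lambda>m. {restrict x {0..<m}})"
  have S_eq: "S k = PiE {0..<k} (\<lambda>i. {x i})" for k
    by (auto simp: S_def PiE_iff extensional_def fun_eq_iff)
  have S_sets: "S k \<in> sets (PiM {0..<k} (\<lambda>_. count_space V))" if "k \<le> Suc m" for k
    unfolding S_eq using x that by (intro sets_PiM_I_finite) auto
  define p where "p = (\<lambda>k. case k of 0 \<Rightarrow> of_bool (x 0 = z) | Suc j \<Rightarrow> K (x j) (x (Suc j)))"
  have p_nonneg: "0 \<le> p k" if "k \<le> m" for k
    using that assms(2) x by (auto simp: p_def stochastic_def split: nat.split)
  have step: "emeasure (chain_step V K z k (restrict x {0..<k})) {x k} = ennreal (p k)"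
    if "k \<le> m" for k
    using that x assms(1)
    by (cases k) (auto simp: chain_step_def p_def emeasure_point_measure_finite indicator_def)
  have eP: "emeasure (IT.eP k \<omega>) (S (Suc k)) = ennreal (p k) * indicator (S k) \<omega>"
    if "k \<le> m" and \<omega>: "\<omega> \<in> space (PiM {0..<k} (\<lambda>_. count_space V))" for k \<omega>
  proof -
    have upd: "fun_upd \<omega> k y = restrict x {0..<Suc k} \<longleftrightarrow> \<omega> = restrict x {0..<k} \<and> y = x k" for y
    proof -
      have "\<And>i. \<not> i < k \<Longrightarrow> \<omega> i = undefined"
        using \<omega> by (auto simp: space_PiM PiE_iff extensional_def)
      then show ?thesis
        by (auto simp: fun_eq_iff restrict_def less_Suc_eq)
    qed
    have "emeasure (IT.eP k \<omega>) (S (Suc k)) =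
        emeasure (chain_step V K z k \<omega>) ((\<lambda>y. fun_upd \<omega> k y) -` S (Suc k) \<inter> V)"
      using IT.emeasure_eP[OF \<omega>] S_sets[of "Suc k"] \<open>k \<le> m\<close> by simp
    also have "(\<lambda>y. fun_upd \<omega> k y) -` S (Suc k) \<inter> V = (if \<omega> \<in> S k then {x k} else {})"
      using x[of k] \<open>k \<le> m\<close> unfolding S_def vimage_def singleton_iff upd by auto
    also have "emeasure (chain_step V K z k \<omega>) \<dots> = ennreal (p k) * indicator (S k) \<omega>"
      using step[OF \<open>k \<le> m\<close>] by (auto simp: S_def)
    finally show ?thesis .
  qed
  have C: "emeasure (IT.C 0 k (\<lambda>_. undefined)) (S k) = (\<Prod>i<k. ennreal (p i))"
    if "k \<le> Suc m" for k
    using that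
  proof (induction k)
    case 0
    then show ?case
      using S_sets[of 0] by (simp add: S_def restrict_def)
  next
    case (Suc k)
    let ?C = "IT.C 0 k (\<lambda>_. undefined)"
    have sp: "space ?C = space (PiM {0..<k} (\<lambda>_. count_space V))"
      and st: "sets ?C = sets (PiM {0..<k} (\<lambda>_. count_space V))"
      using IT.space_C[of _ 0 k] IT.sets_C[of _ 0 k] by (auto simp: space_PiM)
    have "space ?C \<noteq> {}"
      unfolding sp using \<open>z \<in> V\<close> by (auto simp: space_PiM PiE_eq_empty_iff)
    moreover have "IT.eP k \<in> measurable ?C (subprob_algebra (PiM {0..<Suc k} (\<lambda>_. count_space V)))"
      using IT.measurable_eP[of k] measurable_cong_sets[OF st refl] by blast
    ultimately have "emeasure (?C \<bind> IT.eP k) (S (Suc k)) =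
        (\<integral>\<^sup>+\<omega>. emeasure (IT.eP k \<omega>) (S (Suc k)) \<partial>?C)"
      using S_sets[OF Suc.prems] by (rule emeasure_bind)
    also have "\<dots> = (\<integral>\<^sup>+\<omega>. ennreal (p k) * indicator (S k) \<omega> \<partial>?C)"
      using Suc.prems by (intro nn_integral_cong eP) (auto simp: sp)
    also have "\<dots> = ennreal (p k) * emeasure ?C (S k)"
      using S_sets[of k] Suc.prems by (intro nn_integral_cmult_indicator) (auto simp: st)
    finally show ?case
      using Suc by (simp add: mult.commute)
  qed
  have law: "chain_law V K z = IT.PF.lim"
    by (simp add: chain_law_def)
  have "{\<omega> \<in> space (chain_law V K z). \<forall>i\<le>m. \<omega> i = x i} = IT.PF.emb UNIV {0..<Suc m} (S (Suc m))"
    unfolding law by (auto simp: prod_emb_def S_def space_PiM fun_eq_iff restrict_def less_Suc_eq_le)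
      (metis (full_types))
  moreover have "emeasure IT.PF.lim (IT.PF.emb UNIV {0..<Suc m} (S (Suc m))) =
      emeasure (IT.CI {0..<Suc m}) (S (Suc m))"
    using S_sets[of "Suc m"] by (intro IT.lim) auto
  moreover have "\<dots> = emeasure (IT.C 0 (Suc m) (\<lambda>_. undefined))
      (IT.PF.emb {0..<Suc m} {0..<Suc m} (S (Suc m)))"
    using S_sets[of "Suc m"] by (intro IT.emeasure_CI) auto
  moreover have "IT.PF.emb {0..<Suc m} {0..<Suc m} (S (Suc m)) = S (Suc m)"
    using sets.sets_into_space[OF S_sets[of "Suc m"]] by (intro prod_emb_id) (simp add: space_PiM)
  moreover have "(\<Prod>i<Suc m. ennreal (p i)) = ennreal (\<Prod>i<Suc m. p i)"
    using p_nonneg by (intro prod_ennreal) auto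
  moreover have "(\<Prod>i<Suc m. p i) = of_bool (x 0 = z) * (\<Prod>i<m. K (x i) (x (Suc i)))"
    by (subst prod.lessThan_Suc_shift) (simp add: p_def)
  ultimately show ?thesis
    using C[of "Suc m"] by (simp add: law del: IT.C.simps prod.lessThan_Suc)
qed

end

theory Submission
  imports Defs
begin

text \<open>
  A set \<open>A\<close> of mass at least \<open>\<alpha>\<close> occupies a fraction at least \<open>\<alpha>/2\<close> of each part in some union
  \<open>\<Union>i\<in>I. \<Omega>\<^sub>i\<close> of mass at least \<open>\<alpha>/2\<close>. If \<open>A\<close> is not hit up to time \<open>T\<close>, then either every part
  with \<open>i \<in> I\<close> is visited fewer than \<open>t\<close> times, or for some \<open>i \<in> I\<close> the first \<open>t\<close> steps of the trace
  on \<open>\<Omega>\<^sub>i\<close> avoid \<open>A\<close>. The trace is again an irreducible, lazy, reversible chain, so its hitting times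
  of \<open>A\<close> have mean at most \<open>\<phi>\<^sub>i / c'\<close>, and the latter event has probability at most
  \<open>exp (- \<lfloor>c' t / (e \<phi>\<^sub>i)\<rfloor>)\<close>. Hence \<open>A\<close> is missed up to time \<open>\<T>'\<close> with probability at most \<open>1/4\<close> from
  every starting point, and summing the geometric series gives \<open>E\<^sub>z \<tau>\<^sub>A \<le> 4/3 \<T>'\<close>.
\<close>

subsection \<open>Trajectories and first-step analysis\<close>

text \<open>The fraction \<open>\<alpha>/2\<close> comes from splitting the mass of
  \<open>A\<close>: the parts in which \<open>A\<close> has relative mass below
  \<open>\<alpha>/2\<close> hold at most \<open>\<alpha>/2\<close> of it in total, so the remaining
  parts must account for the other \<open>\<alpha>/2\<close>. The main obstacle is to relate the
  chain to its traces, whose clocks run at random speed. The strong Markov property is not invoked.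
  Instead, probabilities are described by recursions obtained from conditioning on the first step,
  and the chain is compared with a trace by induction on time. Almost sure recurrence is replaced by
  a maximum principle for subharmonic functions, and reversibility of the trace by reversing
  excursions of each length. Degenerate cases shape several statements. The universal constants
  concern chains with at least two states, whereas a part may be a single point. The least
  \<open>T\<close> defining the time scale has its property only if some \<open>T\<close> is
  admissible, so one must be exhibited. Mixing times occur in denominators and therefore have to be
  shown positive.\<close>

locale finite_chain =
  fixes V :: "'a set" and K :: "'a \<Rightarrow> 'a \<Rightarrow> real"
  assumes finite_V: "finite V" and stochastic_K: "stochastic V K"
begin

abbreviation "paths \<equiv> PiM (UNIV :: nat set) (\<lambda>_. count_space V)"

lemma K_nonneg: "x \<in> V \<Longrightarrow> y \<in> V \<Longrightarrow> 0 \<le> K x y"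
  and sum_K: "x \<in> V \<Longrightarrow> (\<Sum>y\<in>V. K x y) = 1"
  using stochastic_K by (auto simp: stochastic_def)

lemma space_paths: "space paths = {\<omega>. \<forall>t. \<omega> t \<in> V}"
  by (auto simp: space_PiM PiE_iff)

lemma sets_component: "{\<omega> \<in> space paths. \<omega> t \<in> A} \<in> sets paths"
proof -
  have "(\<lambda>\<omega>. \<omega> t) -` (A \<inter> V) \<inter> space paths \<in> sets paths"
    by (rule measurable_sets[OF measurable_component_singleton]) auto
  moreover have "(\<lambda>\<omega>. \<omega> t) -` (A \<inter> V) \<inter> space paths = {\<omega> \<in> space paths. \<omega> t \<in> A}"
    by (auto simp: space_paths)
  ultimately show ?thesis
    by simp
qed

lemma pred_component [measurable]: "Measurable.pred paths (\<lambda>\<omega>. \<omega> t \<in> A)"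
  by (simp add: pred_def sets_component)

lemma pred_component_eq [measurable]: "Measurable.pred paths (\<lambda>\<omega>. \<omega> t = y)"
  using pred_component[of t "{y}"] by simp

lemma sets_chain_law: "z \<in> V \<Longrightarrow> sets (chain_law V K z) = sets paths"
  and prob_space_chain_law: "z \<in> V \<Longrightarrow> prob_space (chain_law V K z)"
proof -
  assume z: "z \<in> V"
  interpret IT: Ionescu_Tulcea "chain_step V K z" "\<lambda>_. count_space V"
    using finite_V stochastic_K z by (intro Ionescu_Tulcea_chain_step)
  have law: "chain_law V K z = IT.PF.lim"
    by (simp add: chain_law_def)
  show "sets (chain_law V K z) = sets paths"
    by (simp add: law)
  have "emeasure (chain_law V K z) (space (chain_law V K z)) =
      (\<Sum>y\<in>V. emeasure (chain_law V K z) {\<omega> \<in> space (chain_law V K z). \<omega> 0 = y})"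
    unfolding law using finite_V
    using sets_component[of 0 "{_}"]
    by (subst sum_emeasure)
      (auto simp: disjoint_family_on_def space_paths intro!: arg_cong2[where f=emeasure])
  also have "\<dots> = (\<Sum>y\<in>V. ennreal (of_bool (y = z)))"
    using emeasure_chain_law_cylinder[OF finite_V stochastic_K z, of 0 "\<lambda>_. _"]
    by (intro sum.cong) auto
  also have "\<dots> = 1"
    using z finite_V by (subst sum_ennreal) (auto simp: of_bool_def)
  finally show "prob_space (chain_law V K z)"
    by (rule prob_spaceI)
qed

lemma space_chain_law: "z \<in> V \<Longrightarrow> space (chain_law V K z) = space paths"
  using sets_eq_imp_space_eq[OF sets_chain_law] .

section \<open>Cylinders as a pi-system generating the path space\<close>

definition cylinder :: "nat \<Rightarrow> (nat \<Rightarrow> 'a) \<Rightarrow> (nat \<Rightarrow> 'a) set" where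
  "cylinder m x = {\<omega> \<in> space paths. \<forall>i\<le>m. \<omega> i = x i}"

text \<open>The empty set is included because incompatible initial segments give disjoint cylinders,
  and the family has to be closed under intersection.\<close>

definition cylinders :: "(nat \<Rightarrow> 'a) set set" where
  "cylinders = insert {} {cylinder m x | m x. \<forall>i\<le>m. x i \<in> V}"

lemma cylinder_Int_cylinder:
  assumes "m \<le> m'"
  shows "cylinder m x \<inter> cylinder m' x' = (if \<forall>i\<le>m. x i = x' i then cylinder m' x' else {})"
  using assms by (auto simp: cylinder_def)

lemma Int_stable_cylinders: "Int_stable cylinders"
proof (rule Int_stableI)
  have *: "cylinder m x \<inter> cylinder m' x' \<in> cylinders"
    if "m \<le> m'" "\<forall>i\<le>m'. x' i \<in> V" for m m' x x'
    using that unfolding cylinder_Int_cylinder[OF that(1)] by (auto simp: cylinders_def)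
  show "a \<inter> b \<in> cylinders" if a: "a \<in> cylinders" and b: "b \<in> cylinders" for a b
  proof (cases "a = {} \<or> b = {}")
    case False
    then obtain m x m' x' where "a = cylinder m x" "\<forall>i\<le>m. x i \<in> V"
      "b = cylinder m' x'" "\<forall>i\<le>m'. x' i \<in> V"
      using a b by (auto simp: cylinders_def)
    then show ?thesis
      using *[of m m' x' x] *[of m' m x x'] by (cases "m \<le> m'") (auto simp: Int_commute)
  qed (auto simp: cylinders_def)
qed

text \<open>Since \<open>V\<close> is finite, there are finitely many initial segments up to time
  \<open>m\<close>; the event is a finite union of their cylinders.\<close>

lemma component_in_sigma_cylinders:
  assumes "A \<subseteq> V"
  shows "{\<omega> \<in> space paths. \<omega> m \<in> A} \<in> sigma_sets (space paths) cylinders"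
proof -
  interpret sigma_algebra "space paths" "sigma_sets (space paths) cylinders"
    by (rule sigma_algebra_sigma_sets) (auto simp: cylinders_def cylinder_def)
  let ?X = "{x \<in> PiE {..m} (\<lambda>_. V). x m \<in> A}"
  have "{\<omega> \<in> space paths. \<omega> m \<in> A} = (\<Union>x\<in>?X. cylinder m x)"
  proof (intro equalityI subsetI)
    fix \<omega> assume "\<omega> \<in> {\<omega> \<in> space paths. \<omega> m \<in> A}"
    then have "restrict \<omega> {..m} \<in> ?X" "\<omega> \<in> cylinder m (restrict \<omega> {..m})"
      by (auto simp: space_paths cylinder_def)
    then show "\<omega> \<in> (\<Union>x\<in>?X. cylinder m x)"
      by blast
  qed (auto simp: cylinder_def)
  also have "\<dots> \<in> sigma_sets (space paths) cylinders"
    using finite_V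
    by (intro finite_UN finite_subset[OF _ finite_PiE[of "{..m}" "\<lambda>_. V"]])
      (auto simp: cylinders_def intro!: sigma_sets.Basic)
  finally show ?thesis .
qed

lemma sets_paths: "sets paths = sigma_sets (space paths) cylinders"
proof (intro equalityI)
  have "{f \<in> PiE UNIV (\<lambda>_. V). f i \<in> A} \<in> sigma_sets (space paths) cylinders" if "A \<subseteq> V" for i A
    using component_in_sigma_cylinders[OF that, of i] by (simp add: space_PiM)
  then show "sets paths \<subseteq> sigma_sets (space paths) cylinders"
    unfolding sets_PiM_single space_PiM space_count_space by (intro sigma_sets_mono) auto
  have "cylinder m x \<in> sets paths" for m x
    unfolding cylinder_def
    by measurable
  then show "sigma_sets (space paths) cylinders \<subseteq> sets paths"
    by (intro sets.sigma_sets_subset) (auto simp: cylinders_def)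
qed

lemma case_nat_measurable: "z \<in> V \<Longrightarrow> case_nat z \<in> measurable paths paths"
  by (intro measurable_PiM_single') (auto simp: space_paths split: nat.split)

lemma emeasure_cylinder:
  assumes "z \<in> V" "\<And>i. i \<le> m \<Longrightarrow> x i \<in> V"
  shows "emeasure (chain_law V K z) (cylinder m x) =
    ennreal (of_bool (x 0 = z) * (\<Prod>i<m. K (x i) (x (Suc i))))"
  using emeasure_chain_law_cylinder[OF finite_V stochastic_K assms]
  by (simp add: cylinder_def space_chain_law[OF assms(1)])

lemma emeasure_first_step_cylinder:
  assumes z: "z \<in> V" and x: "\<And>i. i \<le> m \<Longrightarrow> x i \<in> V"
  shows "emeasure (chain_law V K z) (cylinder m x) =
    (\<Sum>y\<in>V. ennreal (K z y) *
       emeasure (chain_law V K y) (case_nat z -` cylinder m x \<inter> space paths))"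
proof (cases m)
  case 0
  have "case_nat z -` cylinder m x \<inter> space paths = (if x 0 = z then space paths else {})"
    using z by (auto simp: 0 cylinder_def space_paths split: nat.split)
  moreover have "emeasure (chain_law V K y) (space paths) = 1" if "y \<in> V" for y
    using prob_space.emeasure_space_1[OF prob_space_chain_law[OF that]] that
    by (simp add: space_chain_law)
  moreover have "(\<Sum>y\<in>V. ennreal (K z y)) = 1"
    using z by (subst sum_ennreal) (auto simp: K_nonneg sum_K)
  ultimately show ?thesis
    using emeasure_cylinder[OF z x] by (simp add: 0)
next
  case (Suc k)
  have pre: "case_nat z -` cylinder m x \<inter> space paths =
      (if x 0 = z then cylinder k (\<lambda>i. x (Suc i)) else {})"
  proof -
    have "(\<forall>i\<le>m. case_nat z \<omega> i = x i) \<longleftrightarrow> z = x 0 \<and> (\<forall>i\<le>k. \<omega> i = x (Suc i))" for \<omega>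
      unfolding Suc by (metis Suc_le_mono le0 not0_implies_Suc old.nat.simps(4,5))
    moreover have "case_nat z \<omega> \<in> space paths" if "\<omega> \<in> space paths" for \<omega>
      using that z by (auto simp: space_paths split: nat.split)
    ultimately show ?thesis
      by (auto simp: cylinder_def)
  qed
  have x1: "x (Suc 0) \<in> V"
    using x[of 1] Suc by simp
  have "(\<Sum>y\<in>V. ennreal (K z y) * emeasure (chain_law V K y) (cylinder k (\<lambda>i. x (Suc i)))) =
      (\<Sum>y\<in>V. if y = x (Suc 0) then
         ennreal (K z (x (Suc 0)) * (\<Prod>i<k. K (x (Suc i)) (x (Suc (Suc i))))) else 0)"
    using x z x1 Suc
    by (intro sum.cong) (auto simp: emeasure_cylinder ennreal_mult' K_nonneg)
  also have "\<dots> = ennreal (K z (x (Suc 0)) * (\<Prod>i<k. K (x (Suc i)) (x (Suc (Suc i)))))"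
    using x1 finite_V by simp
  finally show ?thesis
    unfolding pre using emeasure_cylinder[OF z x]
    by (auto simp: Suc prod.lessThan_Suc_shift simp del: prod.lessThan_Suc)
qed

text \<open>The Markov property at time 1. On cylinders it amounts to splitting off the first factor
  of the product formula; both sides are measures in \<open>E\<close>, so agreement on this
  pi-system extends to all measurable events.\<close>

lemma emeasure_first_step:
  assumes z: "z \<in> V" and E: "E \<in> sets paths"
  shows "emeasure (chain_law V K z) E =
    (\<Sum>y\<in>V. ennreal (K z y) * emeasure (chain_law V K y) (case_nat z -` E \<inter> space paths))"
proof -
  have vimage_sets: "case_nat z -` A \<inter> space paths \<in> sets paths" if "A \<in> sets paths" for A
    using measurable_sets[OF case_nat_measurable[OF z] that] .
  have cz: "\<omega> \<in> space paths \<Longrightarrow> case_nat z \<omega> \<in> space paths" for \<omega>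
    using measurable_space[OF case_nat_measurable[OF z]] .
  have "cylinders \<subseteq> Pow (space paths)"
    by (auto simp: cylinders_def cylinder_def)
  from Int_stable_cylinders this E[unfolded sets_paths] show ?thesis
  proof (induction rule: sigma_sets_induct_disjoint)
    case (basic A)
    then show ?case
      using emeasure_first_step_cylinder[OF z] by (auto simp: cylinders_def)
  next
    case (compl A)
    then have A: "A \<in> sets paths"
      by (simp add: sets_paths)
    have c: "emeasure (chain_law V K y) (space paths - B) = 1 - emeasure (chain_law V K y) B"
      if "y \<in> V" "B \<in> sets paths" for y B
      using prob_space.emeasure_space_1[OF prob_space_chain_law[OF that(1)]] that
        emeasure_compl[of B "chain_law V K y"]
      by (simp add: space_chain_law sets_chain_law
          prob_space.finite_measure[OF prob_space_chain_law] finite_measure.emeasure_finite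
          infinity_ennreal_def)
    have pre: "case_nat z -` (space paths - A) \<inter> space paths =
        space paths - (case_nat z -` A \<inter> space paths)"
      using cz by auto
    \<comment> \<open>Subtraction on \<open>ennreal\<close> is truncated, so the complement is
      computed with real numbers \<open>p y\<close> between 0 and 1.\<close>
    define p where "p y = measure (chain_law V K y) (case_nat z -` A \<inter> space paths)" for y
    have p: "emeasure (chain_law V K y) (case_nat z -` A \<inter> space paths) = ennreal (p y)"
      "0 \<le> p y" "p y \<le> 1" if "y \<in> V" for y
      using prob_space_chain_law[OF that]
      by (auto simp: p_def prob_space.prob_le_1 finite_measure.emeasure_eq_measure
          prob_space.finite_measure)
    have "emeasure (chain_law V K z) (space paths - A) = 1 - (\<Sum>y\<in>V. ennreal (K z y) * ennreal (p y))"
      using compl.IH by (simp add: c[OF z A] p)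
    also have "\<dots> = 1 - ennreal (\<Sum>y\<in>V. K z y * p y)"
      using z by (subst sum_ennreal[symmetric]) (auto simp: p K_nonneg ennreal_mult)
    also have "\<dots> = ennreal ((\<Sum>y\<in>V. K z y) - (\<Sum>y\<in>V. K z y * p y))"
      using z by (subst ennreal_1[symmetric], subst ennreal_minus)
        (auto simp: p K_nonneg sum_K intro!: sum_nonneg)
    also have "\<dots> = ennreal (\<Sum>y\<in>V. K z y * (1 - p y))"
      by (simp add: sum_subtractf algebra_simps)
    also have "\<dots> = (\<Sum>y\<in>V. ennreal (K z y) * (1 - ennreal (p y)))"
      using z by (subst sum_ennreal[symmetric])
        (auto simp: p K_nonneg ennreal_mult ennreal_minus[symmetric] intro!: sum.cong)
    finally show ?case
      unfolding pre using vimage_sets[OF A] by (simp add: c p)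
  next
    case (union A)
    then have A: "\<And>i. A i \<in> sets paths"
      by (auto simp: sets_paths)
    have "emeasure (chain_law V K z) (\<Union>i. A i) = (\<Sum>i. emeasure (chain_law V K z) (A i))"
      using A union.hyps z by (intro suminf_emeasure[symmetric]) (auto simp: sets_chain_law)
    also have "\<dots> = (\<Sum>i. \<Sum>y\<in>V. ennreal (K z y) *
        emeasure (chain_law V K y) (case_nat z -` A i \<inter> space paths))"
      using union.IH by simp
    also have "\<dots> = (\<Sum>y\<in>V. ennreal (K z y) *
        (\<Sum>i. emeasure (chain_law V K y) (case_nat z -` A i \<inter> space paths)))"
      by (subst suminf_sum) auto
    also have "\<dots> = (\<Sum>y\<in>V. ennreal (K z y) *
        emeasure (chain_law V K y) (\<Union>i. case_nat z -` A i \<inter> space paths))"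
      using A union.hyps vimage_sets
      by (intro sum.cong arg_cong2[where f="(*)"] suminf_emeasure)
        (auto simp: disjoint_family_on_def sets_chain_law)
    also have "(\<Union>i. case_nat z -` A i \<inter> space paths) = case_nat z -` (\<Union>i. A i) \<inter> space paths"
      by auto
    finally show ?case .
  qed simp
qed

lemma chain_prob_eq: "z \<in> V \<Longrightarrow> chain_prob V K z E = measure (chain_law V K z) {\<omega> \<in> space paths. E \<omega>}"
  by (simp add: chain_prob_def space_chain_law)

lemma emeasure_chain_law:
  "z \<in> V \<Longrightarrow> emeasure (chain_law V K z) {\<omega> \<in> space paths. E \<omega>} = ennreal (chain_prob V K z E)"
  using prob_space_chain_law[of z]
  by (simp add: chain_prob_eq finite_measure.emeasure_eq_measure prob_space.finite_measure)

lemma chain_prob_nonneg: "0 \<le> chain_prob V K z E"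
  by (simp add: chain_prob_def)

lemma chain_prob_le_1: "z \<in> V \<Longrightarrow> chain_prob V K z E \<le> 1"
  using prob_space_chain_law[of z] by (simp add: chain_prob_def prob_space.prob_le_1)

lemma chain_prob_True: "z \<in> V \<Longrightarrow> chain_prob V K z (\<lambda>\<omega>. True) = 1"
  using prob_space_chain_law[of z] by (simp add: chain_prob_def prob_space.prob_space)

lemma chain_prob_False: "chain_prob V K z (\<lambda>\<omega>. False) = 0"
  by (simp add: chain_prob_def)

lemma chain_prob_mono:
  assumes "z \<in> V" "Measurable.pred paths F" "\<And>\<omega>. (\<And>t. \<omega> t \<in> V) \<Longrightarrow> E \<omega> \<Longrightarrow> F \<omega>"
  shows "chain_prob V K z E \<le> chain_prob V K z F"
  unfolding chain_prob_eq[OF assms(1)] using assms prob_space_chain_law[of z]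
  by (intro finite_measure.finite_measure_mono)
    (auto simp: space_paths sets_chain_law prob_space.finite_measure pred_def)

text \<open>\<open>case_nat z \<omega>\<close> is the trajectory \<open>\<omega>\<close> with
  \<open>z\<close> put in front. The recursions below arise by simplifying
  \<open>E (case_nat z \<omega>)\<close> for the event at hand.\<close>

lemma chain_prob_first_step:
  assumes z: "z \<in> V" and E: "Measurable.pred paths E"
  shows "chain_prob V K z E = (\<Sum>y\<in>V. K z y * chain_prob V K y (\<lambda>\<omega>. E (case_nat z \<omega>)))"
proof -
  have "case_nat z -` {\<omega> \<in> space paths. E \<omega>} \<inter> space paths =
      {\<omega> \<in> space paths. E (case_nat z \<omega>)}"
    using measurable_space[OF case_nat_measurable[OF z]] by auto
  then have "ennreal (chain_prob V K z E) =
      (\<Sum>y\<in>V. ennreal (K z y) * ennreal (chain_prob V K y (\<lambda>\<omega>. E (case_nat z \<omega>))))"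
    using emeasure_first_step[OF z E[unfolded pred_def]] z by (simp add: emeasure_chain_law)
  also have "\<dots> = ennreal (\<Sum>y\<in>V. K z y * chain_prob V K y (\<lambda>\<omega>. E (case_nat z \<omega>)))"
    using z by (subst sum_ennreal[symmetric])
      (auto simp: K_nonneg ennreal_mult chain_prob_nonneg)
  finally show ?thesis
    using z by (subst (asm) ennreal_inj) (auto simp: chain_prob_nonneg K_nonneg intro!: sum_nonneg)
qed

end

subsection \<open>Transition and survival probabilities\<close>

primrec transition_prob :: "'a set \<Rightarrow> ('a \<Rightarrow> 'a \<Rightarrow> real) \<Rightarrow> nat \<Rightarrow> 'a \<Rightarrow> 'a \<Rightarrow> real" where
  "transition_prob V K 0 x y = of_bool (x = y)"
| "transition_prob V K (Suc t) x y = (\<Sum>w\<in>V. K x w * transition_prob V K t w y)"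

text \<open>\<open>survival V K A t x\<close> is the probability of \<open>\<tau>\<^sub>A \<ge> t\<close>, not of \<open>\<tau>\<^sub>A > t\<close>, for the chain started at \<open>x\<close>.\<close>

primrec survival :: "'a set \<Rightarrow> ('a \<Rightarrow> 'a \<Rightarrow> real) \<Rightarrow> 'a set \<Rightarrow> nat \<Rightarrow> 'a \<Rightarrow> real" where
  "survival V K A 0 x = 1"
| "survival V K A (Suc t) x = of_bool (x \<notin> A) * (\<Sum>y\<in>V. K x y * survival V K A t y)"

text \<open>A hitting time equals the number of \<open>j\<close> that it exceeds. If
  \<open>A\<close> is never hit, every term is 1 and both sides are infinite. Integration turns this
  into the tail-sum formula for the mean.\<close>

lemma hitting_time_eq_suminf:
  "hitting_time A \<omega> = (\<Sum>j. indicator {\<omega>. \<forall>u<Suc j. \<omega> u \<notin> A} \<omega>)"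
proof (cases "\<exists>t. \<omega> t \<in> A")
  case True
  define m where "m = (LEAST t. \<omega> t \<in> A)"
  have m: "\<omega> m \<in> A" "\<And>t. \<omega> t \<in> A \<Longrightarrow> m \<le> t"
    using True by (auto simp: m_def intro: LeastI_ex Least_le)
  have iff: "(\<forall>u<Suc j. \<omega> u \<notin> A) \<longleftrightarrow> j < m" for j
    using m by (meson less_Suc_eq_le linorder_not_le order_trans)
  have "hitting_time A \<omega> = of_nat m"
    unfolding hitting_time_def using m by (intro antisym INF_lower INF_greatest) auto
  also have "\<dots> = (\<Sum>j<m. indicator {\<omega>. \<forall>u<Suc j. \<omega> u \<notin> A} \<omega>)"
    by (simp add: iff indicator_def)
  also have "\<dots> = (\<Sum>j. indicator {\<omega>. \<forall>u<Suc j. \<omega> u \<notin> A} \<omega>)"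
    by (intro suminf_finite[symmetric]) (auto simp: iff indicator_def)
  finally show ?thesis .
next
  case False
  then have "(\<Sum>j. indicator {\<omega>. \<forall>u<Suc j. \<omega> u \<notin> A} \<omega> :: ennreal) = (\<Sum>j. 1)"
    by (simp add: indicator_def)
  also have "\<dots> = top"
  proof (rule ccontr)
    assume "(\<Sum>j :: nat. 1 :: ennreal) \<noteq> top"
    then obtain k where "(\<Sum>j :: nat. 1 :: ennreal) < of_nat k"
      using ennreal_Ex_less_of_nat[of "\<Sum>j :: nat. 1"] by (auto simp: less_top)
    moreover have "(\<Sum>j<k. 1 :: ennreal) \<le> (\<Sum>j. 1)"
      by (intro sum_le_suminf) auto
    ultimately show False
      by (simp add: not_less[symmetric])
  qed
  finally show ?thesis
    using False by (simp add: hitting_time_def)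
qed

context finite_chain
begin

lemma transition_prob_nonneg: "x \<in> V \<Longrightarrow> 0 \<le> transition_prob V K t x y"
  by (induction t arbitrary: x) (auto intro!: sum_nonneg mult_nonneg_nonneg K_nonneg)

lemma chain_prob_eq_transition_prob:
  "x \<in> V \<Longrightarrow> chain_prob V K x (\<lambda>\<omega>. \<omega> t = y) = transition_prob V K t x y"
proof (induction t arbitrary: x)
  case 0
  then show ?case
    using chain_prob_first_step[OF 0 pred_component_eq, of 0 y]
    by (auto simp: chain_prob_True chain_prob_False sum_K)
next
  case (Suc t)
  then show ?case
    using chain_prob_first_step[OF Suc.prems pred_component_eq, of "Suc t" y] by simp
qed

lemma survival_nonneg: "x \<in> V \<Longrightarrow> 0 \<le> survival V K A t x"
  by (induction t arbitrary: x) (auto intro!: sum_nonneg mult_nonneg_nonneg K_nonneg)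

lemma chain_prob_eq_survival:
  "x \<in> V \<Longrightarrow> chain_prob V K x (\<lambda>\<omega>. \<forall>u<t. \<omega> u \<notin> A) = survival V K A t x"
proof (induction t arbitrary: x)
  case 0
  then show ?case
    by (simp add: chain_prob_True)
next
  case (Suc t)
  have "Measurable.pred paths (\<lambda>\<omega>. \<forall>u<Suc t. \<omega> u \<notin> A)"
    by measurable
  from chain_prob_first_step[OF Suc.prems this] show ?case
    using Suc by (auto simp: All_less_Suc2 chain_prob_False)
qed

lemma survival_le_1: "x \<in> V \<Longrightarrow> survival V K A t x \<le> 1"
  using chain_prob_le_1[of x "\<lambda>\<omega>. \<forall>u<t. \<omega> u \<notin> A"] by (simp only: chain_prob_eq_survival)

lemma expected_hitting_time_eq:
  assumes "x \<in> V"
  shows "expected_hitting_time V K x A = (\<Sum>j. ennreal (survival V K A (Suc j) x))"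
proof -
  have m: "{\<omega> \<in> space paths. \<forall>u<Suc j. \<omega> u \<notin> A} \<in> sets paths" for j
    by measurable
  have "expected_hitting_time V K x A =
      (\<integral>\<^sup>+\<omega>. (\<Sum>j. indicator {\<omega> \<in> space paths. \<forall>u<Suc j. \<omega> u \<notin> A} \<omega>) \<partial>chain_law V K x)"
    unfolding expected_hitting_time_def hitting_time_eq_suminf using assms
    by (intro nn_integral_cong suminf_cong) (simp add: space_chain_law indicator_def)
  also have "\<dots> = (\<Sum>j. emeasure (chain_law V K x) {\<omega> \<in> space paths. \<forall>u<Suc j. \<omega> u \<notin> A})"
    using assms m by (subst nn_integral_suminf)
      (simp_all add: borel_measurable_indicator sets_chain_law)
  finally show ?thesis
    by (simp only: emeasure_chain_law[OF assms] chain_prob_eq_survival[OF assms])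
qed

lemma survival_Int: "x \<in> V \<Longrightarrow> survival V K (A \<inter> V) t x = survival V K A t x"
  by (induction t arbitrary: x) simp_all

lemma chain_prob_disj_le:
  assumes "z \<in> V" "Measurable.pred paths E" "Measurable.pred paths F"
  shows "chain_prob V K z (\<lambda>\<omega>. E \<omega> \<or> F \<omega>) \<le> chain_prob V K z E + chain_prob V K z F"
proof -
  have "{\<omega> \<in> space paths. E \<omega> \<or> F \<omega>} = {\<omega> \<in> space paths. E \<omega>} \<union> {\<omega> \<in> space paths. F \<omega>}"
    by auto
  then show ?thesis
    using assms by (simp add: chain_prob_eq pred_def sets_chain_law measure_Un_le)
qed

lemma chain_prob_Bex_le:
  assumes "z \<in> V" "finite I" "\<And>i. i \<in> I \<Longrightarrow> Measurable.pred paths (F i)"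
  shows "chain_prob V K z (\<lambda>\<omega>. \<exists>i\<in>I. F i \<omega>) \<le> (\<Sum>i\<in>I. chain_prob V K z (F i))"
proof -
  have "{\<omega> \<in> space paths. \<exists>i\<in>I. F i \<omega>} = (\<Union>i\<in>I. {\<omega> \<in> space paths. F i \<omega>})"
    by auto
  then show ?thesis
    using assms by (simp add: chain_prob_eq pred_def sets_chain_law measure_UNION_le)
qed

section \<open>Tail bounds for hitting times\<close>

lemma survival_add_le:
  assumes "\<And>y. y \<in> V \<Longrightarrow> survival V K A l y \<le> q" and "x \<in> V"
  shows "survival V K A (j + l) x \<le> survival V K A j x * q"
  using assms(2)
proof (induction j arbitrary: x)
  case (Suc j)
  have "(\<Sum>y\<in>V. K x y * survival V K A (j + l) y) \<le> (\<Sum>y\<in>V. K x y * (survival V K A j y * q))"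
    using Suc by (intro sum_mono mult_left_mono K_nonneg) auto
  then show ?case
    by (auto simp: sum_distrib_right mult.assoc)
qed (use assms(1) in auto)

text \<open>Unlike in \<open>survival_add_le\<close>, the state at time \<open>j\<close> is
  inspected by both segments. A bound on the probability of \<open>\<tau>\<^sub>A > T\<close> can
  thus be iterated with period \<open>T\<close> instead of \<open>Suc T\<close>, which keeps
  \<open>T\<close> itself in the final estimate.\<close>

lemma survival_Suc_add_le:
  assumes "\<And>y. y \<in> V \<Longrightarrow> survival V K A (Suc l) y \<le> q" and "x \<in> V"
  shows "survival V K A (Suc (j + l)) x \<le> q * survival V K A (Suc j) x"
  using assms(2)
proof (induction j arbitrary: x)
  case 0
  then show ?case
    using assms(1)[of x] by (auto simp: sum_K split: if_splits)
next
  case (Suc j)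
  have "(\<Sum>y\<in>V. K x y * survival V K A (Suc (j + l)) y) \<le>
      (\<Sum>y\<in>V. K x y * (q * survival V K A (Suc j) y))"
    using Suc by (intro sum_mono mult_left_mono K_nonneg) auto
  then show ?case
    by (auto simp: sum_distrib_left mult_ac simp del: survival.simps(2)
      simp add: survival.simps(2)[of V K A "Suc _"])
qed

text \<open>
  The left-hand side is at most the \<open>k\<close>-th binomial moment of \<open>\<tau>\<^sub>A\<close>. Going through this moment,
  rather than iterating Markov's inequality over blocks of integer length, avoids rounding
  the real number \<open>e H\<close> to an integer block length.
\<close>

lemma binomial_survival_le:
  assumes H: "\<And>y N. y \<in> V \<Longrightarrow> (\<Sum>j<N. survival V K A (Suc j) y) \<le> H" and "x \<in> V"
  shows "real (t choose k) * survival V K A t x \<le> H ^ k"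
  using assms(2)
proof (induction k arbitrary: t x)
  case 0
  then show ?case
    by (simp add: survival_le_1)
next
  case (Suc k)
  show ?case
  proof (cases t)
    case t: (Suc s)
    have "0 \<le> H"
      using H[of x 0] Suc.prems by simp
    \<comment> \<open>The hockey-stick identity expands the coefficient. The \<open>i\<close>-th
      term is then cut at time \<open>Suc (s - i)\<close>, which leaves \<open>i\<close> steps for
      the induction hypothesis.\<close>
    have "real (t choose Suc k) * survival V K A t x =
        (\<Sum>i\<le>s. real (i choose k) * survival V K A t x)"
      by (simp add: t sum_choose_upper[symmetric] sum_distrib_right del: binomial_Suc_Suc survival.simps)
    also have "\<dots> \<le> (\<Sum>i\<le>s. survival V K A (Suc (s - i)) x * H ^ k)"
    proof (rule sum_mono)
      fix i assume i: "i \<in> {..s}"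
      show "real (i choose k) * survival V K A t x \<le> survival V K A (Suc (s - i)) x * H ^ k"
      proof (cases "i choose k = 0")
        case True
        then show ?thesis
          using Suc.prems \<open>0 \<le> H\<close> unfolding True
          by (simp add: survival_nonneg del: survival.simps)
      next
        case False
        then have pos: "real (i choose k) > 0"
          by simp
        have "survival V K A i y \<le> H ^ k / real (i choose k)" if "y \<in> V" for y
          using Suc.IH[OF that, of i] pos by (simp add: field_simps)
        from survival_add_le[OF this Suc.prems, of "Suc (s - i)"]
        have "survival V K A t x \<le> survival V K A (Suc (s - i)) x * (H ^ k / real (i choose k))"
          using i by (simp add: t del: survival.simps)
        then show ?thesis
          using pos by (simp add: field_simps del: survival.simps)
      qed
    qed
    also have "\<dots> = (\<Sum>j<Suc s. survival V K A (Suc j) x) * H ^ k"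
      unfolding sum_distrib_right lessThan_Suc_atMost
      by (rule sum.reindex_bij_witness[where i="\<lambda>i. s - i" and j="\<lambda>i. s - i"]) auto
    also have "\<dots> \<le> H * H ^ k"
      using H[OF Suc.prems, of "Suc s"] \<open>0 \<le> H\<close>
      by (intro mult_right_mono) (simp_all del: survival.simps sum.lessThan_Suc)
    finally show ?thesis
      by simp
  qed (use Suc.prems H[of x 0] in simp)
qed

text \<open>For \<open>k > 0\<close> the assumption on \<open>k\<close> gives
  \<open>(t choose k) \<ge> (t / k) ^ k \<ge> (e * H) ^ k\<close>, so the moment bound
  \<open>H ^ k / (t choose k)\<close> is at most \<open>exp (- k)\<close>. The factor
  \<open>e\<close> in \<open>occupation_bound\<close> originates here.\<close>

lemma survival_le_exp:
  assumes H: "\<And>y N. y \<in> V \<Longrightarrow> (\<Sum>j<N. survival V K A (Suc j) y) \<le> H"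
    and "0 < H" and "x \<in> V" and k: "real k \<le> real t / (exp 1 * H)" and "k \<le> t"
  shows "survival V K A t x \<le> exp (- real k)"
proof (cases "k = 0")
  case True
  then show ?thesis
    using survival_le_1[OF \<open>x \<in> V\<close>] by simp
next
  case False
  have "exp 1 * H \<le> real t / real k"
    using k False \<open>0 < H\<close> by (simp add: field_simps)
  then have "(exp 1 * H) ^ k \<le> (real t / real k) ^ k"
    using \<open>0 < H\<close> by (intro power_mono) auto
  also have "\<dots> \<le> real (t choose k)"
    using \<open>k \<le> t\<close> by (rule binomial_ge_n_over_k_pow_k)
  finally have "(exp 1 * H) ^ k * survival V K A t x \<le> H ^ k"
    using binomial_survival_le[OF H \<open>x \<in> V\<close>, of t k] survival_nonneg[OF \<open>x \<in> V\<close>, of A t]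
    by (meson mult_right_mono order_trans)
  then have "exp 1 ^ k * survival V K A t x \<le> 1"
    using \<open>0 < H\<close> by (simp add: power_mult_distrib field_simps)
  then show ?thesis
    by (simp add: exp_of_nat_mult[symmetric] exp_minus field_simps)
qed

text \<open>The sums \<open>s m\<close> over \<open>m\<close> blocks of length \<open>T\<close> obey
  \<open>s (m + 1) \<le> T + s m / 4\<close>. The fixed point of this recursion is
  \<open>4 / 3 * T\<close>.\<close>

lemma sum_survival_le:
  assumes q: "\<And>y. y \<in> V \<Longrightarrow> survival V K A (Suc T) y \<le> 1 / 4" and "x \<in> V" and "T > 0"
  shows "(\<Sum>j<N. survival V K A (Suc j) x) \<le> 4 / 3 * real T"
proof -
  let ?s = "\<lambda>j. survival V K A (Suc j) x"
  have blocks: "sum ?s {..<m * T} \<le> 4 / 3 * real T" for m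
  proof (induction m)
    case (Suc m)
    have "sum ?s {..<Suc m * T} = sum ?s {..<T} + (\<Sum>j<m * T. ?s (j + T))"
      using sum.atLeastLessThan_concat[of 0 T "T + m * T" ?s]
        sum.shift_bounds_nat_ivl[of ?s 0 T "m * T"]
      by (simp add: lessThan_atLeast0 add.commute del: survival.simps)
    also have "sum ?s {..<T} \<le> real T"
      using sum_bounded_above[of "{..<T}" ?s 1, OF survival_le_1[OF \<open>x \<in> V\<close>]]
      by (simp del: survival.simps)
    also have "(\<Sum>j<m * T. ?s (j + T)) \<le> (\<Sum>j<m * T. 1 / 4 * ?s j)"
      by (intro sum_mono survival_Suc_add_le q \<open>x \<in> V\<close>)
    also have "\<dots> \<le> 1 / 4 * (4 / 3 * real T)"
      unfolding sum_distrib_left[symmetric] using Suc by (intro mult_left_mono) auto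
    finally show ?case
      by simp
  qed simp
  have "sum ?s {..<N} \<le> sum ?s {..<N * T}"
    using \<open>T > 0\<close> survival_nonneg[OF \<open>x \<in> V\<close>]
    by (intro sum_mono2) (simp_all add: lessThan_subset_iff del: survival.simps)
  then show ?thesis
    using blocks[of N] by simp
qed

end

subsection \<open>First passage and occupation times\<close>

text \<open>Taboo probabilities: \<open>t\<close> counts the intermediate states, all outside
  \<open>S\<close>, so the path has \<open>Suc t\<close> steps. For \<open>y \<in> S\<close> this is
  the probability that the return to \<open>S\<close> happens at time \<open>Suc t\<close> and at
  \<open>y\<close>; other \<open>y\<close> occur when a path is cut before its last step.\<close>

primrec first_passage :: "'a set \<Rightarrow> ('a \<Rightarrow> 'a \<Rightarrow> real) \<Rightarrow> 'a set \<Rightarrow> nat \<Rightarrow> 'a \<Rightarrow> 'a \<Rightarrow> real" where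
  "first_passage V K S 0 x y = K x y"
| "first_passage V K S (Suc t) x y = (\<Sum>w\<in>V - S. K x w * first_passage V K S t w y)"

lemma occupation_time_0: "occupation_time S 0 \<omega> = of_bool (\<omega> 0 \<in> S)"
proof -
  have "{u \<in> {0..0}. \<omega> u \<in> S} = (if \<omega> 0 \<in> S then {0} else {})"
    by auto
  then show ?thesis
    by (simp add: occupation_time_def)
qed

lemma occupation_time_case_nat:
  "occupation_time S (Suc T) (case_nat z \<omega>) = of_bool (z \<in> S) + occupation_time S T \<omega>"
proof -
  have "{u \<in> {0..Suc T}. case_nat z \<omega> u \<in> S} =
      (if z \<in> S then {0} else {}) \<union> Suc ` {u \<in> {0..T}. \<omega> u \<in> S}"
    by (auto simp: image_iff gr0_conv_Suc split: nat.splits) (metis not0_implies_Suc)+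
  then show ?thesis
    by (auto simp: occupation_time_def card_image card_insert_if)
qed

lemma occupation_time_mono: "T \<le> T' \<Longrightarrow> occupation_time S T \<omega> \<le> occupation_time S T' \<omega>"
  unfolding occupation_time_def by (intro card_mono) auto

lemma occupation_time_cong:
  "(\<And>u. u \<le> T \<Longrightarrow> \<omega> u = \<omega>' u) \<Longrightarrow> occupation_time S T \<omega> = occupation_time S T \<omega>'"
  unfolding occupation_time_def by (intro arg_cong[where f=card]) auto

context finite_chain
begin

text \<open>An event determined by the states up to time \<open>m\<close> is a finite union of
  cylinders. This covers events about occupation times without any measurability argument for the
  counting itself.\<close>

lemma pred_finite_dimensional:
  assumes "\<And>\<omega> \<omega>'. (\<And>u. u \<le> m \<Longrightarrow> \<omega> u = \<omega>' u) \<Longrightarrow> E \<omega> = E \<omega>'"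
  shows "Measurable.pred paths E"
proof -
  let ?X = "{x \<in> PiE {..m} (\<lambda>_. V). E x}"
  have "{\<omega> \<in> space paths. E \<omega>} = (\<Union>x\<in>?X. cylinder m x)"
  proof (intro equalityI subsetI)
    fix \<omega> assume \<omega>: "\<omega> \<in> {\<omega> \<in> space paths. E \<omega>}"
    moreover have "E (restrict \<omega> {..m}) = E \<omega>"
      by (rule assms) simp
    ultimately have "restrict \<omega> {..m} \<in> ?X" "\<omega> \<in> cylinder m (restrict \<omega> {..m})"
      by (auto simp: space_paths cylinder_def)
    then show "\<omega> \<in> (\<Union>x\<in>?X. cylinder m x)"
      by blast
  next
    fix \<omega> assume "\<omega> \<in> (\<Union>x\<in>?X. cylinder m x)"
    then obtain x where "E x" "\<omega> \<in> cylinder m x"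
      by auto
    then show "\<omega> \<in> {\<omega> \<in> space paths. E \<omega>}"
      using assms[of \<omega> x] by (auto simp: cylinder_def)
  qed
  also have "\<dots> \<in> sets paths"
    using finite_V
    by (intro sets.finite_UN finite_subset[OF _ finite_PiE[of "{..m}" "\<lambda>_. V"]])
      (auto simp: cylinders_def sets_paths intro!: sigma_sets.Basic)
  finally show ?thesis
    by (simp add: pred_def)
qed

lemma chain_prob_sums:
  assumes "z \<in> V" "\<And>t. Measurable.pred paths (E t)"
    and disjoint: "\<And>\<omega> t t'. E t \<omega> \<Longrightarrow> E t' \<omega> \<Longrightarrow> t = t'"
  shows "(\<lambda>t. chain_prob V K z (E t)) sums chain_prob V K z (\<lambda>\<omega>. \<exists>t :: nat. E t \<omega>)"
proof -
  have "(\<lambda>t. measure (chain_law V K z) {\<omega> \<in> space paths. E t \<omega>}) sums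
      measure (chain_law V K z) (\<Union>t. {\<omega> \<in> space paths. E t \<omega>})"
    using assms prob_space_chain_law[OF assms(1)]
    by (intro finite_measure.finite_measure_UNION prob_space.finite_measure)
      (auto simp: sets_chain_law disjoint_family_on_def pred_def)
  moreover have "(\<Union>t. {\<omega> \<in> space paths. E t \<omega>}) = {\<omega> \<in> space paths. \<exists>t. E t \<omega>}"
    by auto
  ultimately show ?thesis
    by (simp add: chain_prob_eq[OF assms(1)])
qed

text \<open>Time reversal exchanges the first and the last step of an excursion, so a recursion from
  the other end is required.\<close>

lemma first_passage_last_step:
  "first_passage V K S (Suc t) x y = (\<Sum>w\<in>V - S. first_passage V K S t x w * K w y)"
proof (induction t arbitrary: x)
  case (Suc t)
  have "first_passage V K S (Suc (Suc t)) x y =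
      (\<Sum>w\<in>V - S. \<Sum>v\<in>V - S. K x w * first_passage V K S t w v * K v y)"
    unfolding first_passage.simps(2)[of V K S "Suc t"] Suc by (simp add: sum_distrib_left mult.assoc)
  also have "\<dots> = (\<Sum>v\<in>V - S. first_passage V K S (Suc t) x v * K v y)"
    by (subst sum.swap) (simp add: sum_distrib_right)
  finally show ?case .
qed simp

text \<open>Averaging over the first step exempts time 0 from the taboo, as \<open>x\<close> itself
  may lie in \<open>S\<close>.\<close>

lemma sum_chain_prob_eq_first_passage:
  assumes y: "y \<in> V" and "x \<in> V"
  shows "(\<Sum>w\<in>V. K x w * chain_prob V K w (\<lambda>\<omega>. \<omega> t = y \<and> (\<forall>u<t. \<omega> u \<notin> S))) =
    first_passage V K S t x y"
  using assms(2)
proof (induction t arbitrary: x)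
  case 0
  have "(\<Sum>w\<in>V. K x w * chain_prob V K w (\<lambda>\<omega>. \<omega> 0 = y)) = (\<Sum>w\<in>V. if w = y then K x w else 0)"
    by (intro sum.cong) (auto simp: chain_prob_eq_transition_prob)
  then show ?case
    using y finite_V by simp
next
  case (Suc t)
  have "chain_prob V K w (\<lambda>\<omega>. \<omega> (Suc t) = y \<and> (\<forall>u<Suc t. \<omega> u \<notin> S)) =
      of_bool (w \<notin> S) * first_passage V K S t w y" if "w \<in> V" for w
  proof -
    have "Measurable.pred paths (\<lambda>\<omega>. \<omega> (Suc t) = y \<and> (\<forall>u<Suc t. \<omega> u \<notin> S))"
      by measurable
    from chain_prob_first_step[OF that this] show ?thesis
      using Suc.IH[OF that] by (cases "w \<in> S") (simp_all add: All_less_Suc2 chain_prob_False)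
  qed
  then have "(\<Sum>w\<in>V. K x w * chain_prob V K w (\<lambda>\<omega>. \<omega> (Suc t) = y \<and> (\<forall>u<Suc t. \<omega> u \<notin> S))) =
      (\<Sum>w\<in>V - S. K x w * first_passage V K S t w y)"
    using finite_V by (intro sum.mono_neutral_cong_right) auto
  then show ?case
    by simp
qed

lemma first_passage_sums:
  assumes S: "S \<subseteq> V" and x: "x \<in> V" and y: "y \<in> S"
  shows "(\<lambda>t. first_passage V K S t x y) sums trace_kernel V K S x y"
proof -
  let ?E = "\<lambda>t \<omega>. \<omega> t = y \<and> (\<forall>u<t. \<omega> u \<notin> S)"
  have iff: "(\<exists>t\<ge>1. \<omega> t \<in> S) \<and> \<omega> (LEAST t. t \<ge> 1 \<and> \<omega> t \<in> S) = y \<longleftrightarrow>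
      (\<exists>t. \<omega> (Suc t) = y \<and> (\<forall>u<t. \<omega> (Suc u) \<notin> S))" (is "?l \<longleftrightarrow> ?r") for \<omega>
  proof
    assume l: ?l
    define m where "m = (LEAST t. t \<ge> 1 \<and> \<omega> t \<in> S)"
    have "m \<ge> 1 \<and> \<omega> m \<in> S"
      unfolding m_def using l by (intro LeastI_ex[of "\<lambda>t. t \<ge> 1 \<and> \<omega> t \<in> S"]) auto
    then obtain t where t: "m = Suc t"
      by (cases m) auto
    have "\<omega> (Suc u) \<notin> S" if "u < t" for u
      using not_less_Least[of "Suc u" "\<lambda>t. t \<ge> 1 \<and> \<omega> t \<in> S"] that t by (auto simp: m_def)
    then show ?r
      using l t by (auto simp: m_def intro!: exI[of _ t])
  next
    assume ?r
    then obtain t where t: "\<omega> (Suc t) = y" "\<And>u. u < t \<Longrightarrow> \<omega> (Suc u) \<notin> S"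
      by auto
    have "(LEAST t. t \<ge> 1 \<and> \<omega> t \<in> S) = Suc t"
    proof (rule Least_equality)
      fix s assume "s \<ge> 1 \<and> \<omega> s \<in> S"
      then show "Suc t \<le> s"
        using t(2)[of "s - 1"] by (cases s) (auto simp: not_less[symmetric])
    qed (use t y in auto)
    then show ?l
      using t y by auto
  qed
  have m: "Measurable.pred paths (\<lambda>\<omega>. \<exists>t. \<omega> (Suc t) = y \<and> (\<forall>u<t. \<omega> (Suc u) \<notin> S))"
    by measurable
  have mE: "Measurable.pred paths (?E t)" for t
    by measurable
  have "trace_kernel V K S x y = (\<Sum>w\<in>V. K x w * chain_prob V K w (\<lambda>\<omega>. \<exists>t. ?E t \<omega>))"
    unfolding trace_kernel_def iff using chain_prob_first_step[OF x m] by simp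
  moreover have "(\<lambda>t. \<Sum>w\<in>V. K x w * chain_prob V K w (?E t)) sums
      (\<Sum>w\<in>V. K x w * chain_prob V K w (\<lambda>\<omega>. \<exists>t. ?E t \<omega>))"
  proof (intro sums_sum sums_mult chain_prob_sums mE)
    \<comment> \<open>Of two different times, the later event forbids \<open>S\<close> at the
      earlier one, where the state is \<open>y \<in> S\<close>.\<close>
    fix \<omega> and t t' :: nat assume "?E t \<omega>" "?E t' \<omega>"
    then show "t = t'"
      using y by (cases t t' rule: linorder_cases) auto
  qed
  ultimately show ?thesis
    using sum_chain_prob_eq_first_passage[OF _ x] S y by (simp add: subset_iff)
qed

lemma trace_kernel_nonneg: "0 \<le> trace_kernel V K S x y"
  by (simp add: trace_kernel_def chain_prob_nonneg)

text \<open>The point \<open>x\<close> may lie outside \<open>S\<close>; there the trace kernel is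
  the law of the first entrance into \<open>S\<close>. This is what allows excursions to be unfolded
  one step at a time.\<close>

lemma trace_kernel_first_step:
  assumes "S \<subseteq> V" "x \<in> V" "y \<in> S"
  shows "trace_kernel V K S x y = K x y + (\<Sum>w\<in>V - S. K x w * trace_kernel V K S w y)"
proof -
  have "(\<lambda>t. first_passage V K S (Suc t) x y) sums (\<Sum>w\<in>V - S. K x w * trace_kernel V K S w y)"
    unfolding first_passage.simps using assms
    by (intro sums_sum sums_mult first_passage_sums) auto
  from sums_Suc[OF this] show ?thesis
    using first_passage_sums[OF assms] sums_unique2 by (metis add.commute first_passage.simps(1))
qed

lemma trace_kernel_ge:
  assumes "S \<subseteq> V" "x \<in> V" "y \<in> S"
  shows "K x y \<le> trace_kernel V K S x y"
  using assms trace_kernel_first_step[OF assms]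
  by (auto intro!: sum_nonneg mult_nonneg_nonneg K_nonneg trace_kernel_nonneg)

end

subsection \<open>Irreducible chains and traces\<close>

locale irreducible_finite_chain = finite_chain +
  assumes irreducible: "irreducible_chain V K"
begin

lemma transition_prob_pos: "x \<in> V \<Longrightarrow> y \<in> V \<Longrightarrow> \<exists>t. transition_prob V K t x y > 0"
  using irreducible by (simp add: irreducible_chain_def chain_prob_eq_transition_prob)

text \<open>If the maximum \<open>M\<close> exceeded \<open>c\<close>, it would be attained only
  outside \<open>S\<close>, where \<open>h\<close> is at most its average over the next step. Hence
  all states reachable in one step also have value \<open>M\<close>, and irreducibility carries this
  value into \<open>S\<close>, a contradiction.\<close>

lemma maximum_principle:
  assumes "S \<subseteq> V" "S \<noteq> {}"
    and sub: "\<And>x. x \<in> V - S \<Longrightarrow> h x \<le> (\<Sum>y\<in>V. K x y * h y)"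
    and bound: "\<And>x. x \<in> S \<Longrightarrow> h x \<le> c"
    and "x \<in> V"
  shows "h x \<le> c"
proof (rule ccontr)
  assume "\<not> h x \<le> c"
  define M where "M = Max (h ` V)"
  have le_M: "h y \<le> M" if "y \<in> V" for y
    using that finite_V by (simp add: M_def)
  have "c < M"
    using le_M[OF \<open>x \<in> V\<close>] \<open>\<not> h x \<le> c\<close> by simp
  obtain x0 where x0: "x0 \<in> V" "h x0 = M"
    using Max_in[of "h ` V"] finite_V \<open>x \<in> V\<close> unfolding M_def by fastforce
  have closed: "h w = M" if v: "v \<in> V" "h v = M" and w: "w \<in> V" "K v w > 0" for v w
  proof (rule ccontr)
    assume "h w \<noteq> M"
    then have "h w < M"
      using le_M[OF w(1)] by simp
    then have "(\<Sum>y\<in>V. K v y * h y) < (\<Sum>y\<in>V. K v y * M)"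
      using finite_V v w le_M
      by (intro sum_strict_mono_ex1 bexI[of _ w]) (auto intro!: mult_left_mono K_nonneg)
    also have "\<dots> = M"
      using v by (simp add: sum_distrib_right[symmetric] sum_K)
    finally show False
      using sub[of v] bound[of v] v \<open>c < M\<close> by force
  qed
  have reach: "h y = M" if "v \<in> V" "h v = M" "transition_prob V K t v y > 0" "y \<in> V" for t v y
    using that
  proof (induction t arbitrary: v)
    case (Suc t)
    obtain w where w: "w \<in> V" "K v w * transition_prob V K t w y > 0"
      using Suc.prems(3) sum_nonpos[of V "\<lambda>w. K v w * transition_prob V K t w y"]
      by (force simp: not_le[symmetric])
    then have "K v w > 0" "transition_prob V K t w y > 0"
      using K_nonneg[OF Suc.prems(1) w(1)] transition_prob_nonneg[OF w(1), of t y]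
      by (auto simp: zero_less_mult_iff)
    then show ?case
      using Suc.IH[OF w(1)] closed[OF Suc.prems(1,2) w(1)] Suc.prems(4) by simp
  qed (auto split: if_splits)
  obtain s where s: "s \<in> S" "s \<in> V"
    using assms(1,2) by auto
  then show False
    using transition_prob_pos[OF x0(1) s(2)] reach[OF x0] bound[OF s(1)] \<open>c < M\<close> by force
qed

text \<open>Here \<open>r\<close> is the probability of never entering \<open>S\<close> after time
  0. Its values on \<open>S\<close> are not known beforehand, so the maximum principle is applied to
  \<open>h\<close> and \<open>- h\<close>, where \<open>h\<close> replaces \<open>r\<close> by 0 on
  \<open>S\<close>. Finally \<open>r x\<close> is an average of \<open>h\<close>.\<close>

lemma sum_trace_kernel:
  assumes S: "S \<subseteq> V" "S \<noteq> {}" and "x \<in> V"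
  shows "(\<Sum>y\<in>S. trace_kernel V K S x y) = 1"
proof -
  define r where "r x = 1 - (\<Sum>y\<in>S. trace_kernel V K S x y)" for x
  have r: "r x = (\<Sum>w\<in>V - S. K x w * r w)" if "x \<in> V" for x
  proof -
    have "(\<Sum>y\<in>S. trace_kernel V K S x y) =
        (\<Sum>y\<in>S. K x y) + (\<Sum>w\<in>V - S. K x w * (\<Sum>y\<in>S. trace_kernel V K S w y))"
      using S that unfolding sum_distrib_left
      by (subst sum.swap) (simp add: trace_kernel_first_step[of S x] sum.distrib)
    moreover have "(\<Sum>y\<in>S. K x y) = 1 - (\<Sum>w\<in>V - S. K x w)"
      using sum_K[OF that] sum.subset_diff[OF S(1) finite_V, of "K x"] by simp
    ultimately show ?thesis
      by (simp add: r_def sum_subtractf algebra_simps)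
  qed
  define h where "h w = (if w \<in> S then 0 else r w)" for w
  have h: "r x = (\<Sum>w\<in>V. K x w * h w)" if "x \<in> V" for x
    unfolding r[OF that] using finite_V S by (intro sum.mono_neutral_cong_left) (auto simp: h_def)
  have harmonic: "h x = (\<Sum>w\<in>V. K x w * h w)" if "x \<in> V - S" for x
    using h[of x] that by (simp add: h_def[of x])
  have h_S: "h x = 0" if "x \<in> S" for x
    using that by (simp add: h_def)
  have "h w \<le> 0" if "w \<in> V" for w
    by (rule maximum_principle[OF S _ _ that]) (simp_all only: harmonic[symmetric] h_S order_refl)
  moreover have "- h w \<le> 0" if "w \<in> V" for w
  proof (rule maximum_principle[OF S _ _ that])
    show "- h x \<le> (\<Sum>w\<in>V. K x w * - h w)" if "x \<in> V - S" for x
      using harmonic[OF that] by (simp add: sum_negf)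
  qed (simp add: h_S)
  ultimately have "h w = 0" if "w \<in> V" for w
    using that by force
  then have "r x = 0"
    using h[OF \<open>x \<in> V\<close>] by simp
  then show ?thesis
    by (simp add: r_def)
qed

lemma stochastic_trace_kernel:
  "S \<subseteq> V \<Longrightarrow> S \<noteq> {} \<Longrightarrow> stochastic S (trace_kernel V K S)"
  using sum_trace_kernel by (auto simp: stochastic_def trace_kernel_nonneg subset_iff)

text \<open>A path of positive probability, cut at its visits to \<open>S\<close>, becomes a path of
  the trace. The induction along the path passes through states outside \<open>S\<close>; for these
  the claim is a positive entrance probability at some state of \<open>S\<close> from which the
  trace reaches \<open>y\<close>.\<close>

lemma irreducible_trace_kernel:
  assumes S: "S \<subseteq> V" "S \<noteq> {}"
  shows "irreducible_chain S (trace_kernel V K S)"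
proof -
  let ?Q = "trace_kernel V K S"
  interpret Q: finite_chain S ?Q
    using finite_subset[OF S(1) finite_V] stochastic_trace_kernel[OF S] by unfold_locales
  define reach where "reach x y \<longleftrightarrow> (\<exists>t. transition_prob S ?Q t x y > 0)" for x y
  have reach_refl: "reach x x" for x
    by (auto simp: reach_def intro!: exI[of _ 0])
  have reach_step: "reach x y" if st: "?Q x w > 0" "reach w y" "x \<in> S" "w \<in> S" for x w y
  proof -
    obtain t where "transition_prob S ?Q t w y > 0"
      using st by (auto simp: reach_def)
    then have "0 < ?Q x w * transition_prob S ?Q t w y"
      using st by simp
    also have "\<dots> \<le> transition_prob S ?Q (Suc t) x y"
      using st Q.finite_V
      by (auto intro!: member_le_sum mult_nonneg_nonneg Q.K_nonneg Q.transition_prob_nonneg)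
    finally show ?thesis
      unfolding reach_def by blast
  qed
  have main: "(x \<in> S \<longrightarrow> reach x y) \<and> (x \<notin> S \<longrightarrow> (\<exists>w\<in>S. ?Q x w > 0 \<and> reach w y))"
    if "x \<in> V" "transition_prob V K t x y > 0" "y \<in> S" for t x y
    using that
  proof (induction t arbitrary: x)
    case 0
    then show ?case
      by (auto simp: reach_refl split: if_splits)
  next
    case (Suc t)
    obtain w where w: "w \<in> V" "K x w * transition_prob V K t w y > 0"
      using Suc.prems(2) sum_nonpos[of V "\<lambda>w. K x w * transition_prob V K t w y"]
      by (force simp: not_le[symmetric])
    then have pos: "K x w > 0" "transition_prob V K t w y > 0"
      using K_nonneg[OF Suc.prems(1) w(1)] transition_prob_nonneg[OF w(1), of t y]
      by (auto simp: zero_less_mult_iff)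
    have "\<exists>v\<in>S. ?Q x v > 0 \<and> reach v y"
    proof (cases "w \<in> S")
      case True
      then have "?Q x w > 0"
        using trace_kernel_ge[OF S(1) Suc.prems(1) True] pos by simp
      then show ?thesis
        using Suc.IH[OF w(1) pos(2) Suc.prems(3)] True by auto
    next
      \<comment> \<open>The step to \<open>w\<close> outside \<open>S\<close> merges with the
        ensuing entrance into \<open>S\<close> at \<open>v\<close> to form a single
        transition.\<close>
      case False
      then obtain v where v: "v \<in> S" "?Q w v > 0" "reach v y"
        using Suc.IH[OF w(1) pos(2) Suc.prems(3)] by auto
      have "0 < K x w * ?Q w v"
        using pos v by simp
      also have "\<dots> \<le> (\<Sum>w\<in>V - S. K x w * ?Q w v)"
        using False w Suc.prems finite_V
        by (intro member_le_sum) (auto intro!: mult_nonneg_nonneg K_nonneg trace_kernel_nonneg)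
      also have "\<dots> \<le> ?Q x v"
        using trace_kernel_first_step[OF S(1) Suc.prems(1) v(1)] K_nonneg[OF Suc.prems(1)] v S
        by auto
      finally show ?thesis
        using v by auto
    qed
    then show ?case
      using reach_step by blast
  qed
  show ?thesis
    unfolding irreducible_chain_def
  proof (intro ballI)
    fix x y assume "x \<in> S" "y \<in> S"
    moreover from this obtain t where "transition_prob V K t x y > 0"
      using transition_prob_pos S by blast
    ultimately have "reach x y"
      using main[of x t y] S by auto
    then show "\<exists>t. chain_prob S ?Q x (\<lambda>\<omega>. \<omega> t = y) > 0"
      using \<open>x \<in> S\<close> by (simp add: reach_def Q.chain_prob_eq_transition_prob)
  qed
qed

section \<open>Recurrence and visits to a subset\<close>

lemma pred_occupation_less: "Measurable.pred paths (\<lambda>\<omega>. occupation_time S T \<omega> < s)"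
proof (rule pred_finite_dimensional[of T])
  fix \<omega> \<omega>' :: "nat \<Rightarrow> 'a"
  assume "\<And>u. u \<le> T \<Longrightarrow> \<omega> u = \<omega>' u"
  then have "occupation_time S T \<omega> = occupation_time S T \<omega>'"
    by (rule occupation_time_cong)
  then show "(occupation_time S T \<omega> < s) = (occupation_time S T \<omega>' < s)"
    by simp
qed

text \<open>Almost surely \<open>S\<close> is visited infinitely often, by induction on the number
  of visits. From a state of \<open>S\<close> one visit is spent at time 0 and the induction
  hypothesis applies after one step. Outside \<open>S\<close> the probability is subharmonic, so the
  maximum principle extends the value 0 to all of \<open>V\<close>.\<close>

lemma chain_prob_occupation_bounded_eq_0:
  assumes S: "S \<subseteq> V" "S \<noteq> {}" and "z \<in> V"
  shows "chain_prob V K z (\<lambda>\<omega>. \<forall>T. occupation_time S T \<omega> < t) = 0"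
  using \<open>z \<in> V\<close>
proof (induction t arbitrary: z)
  case 0
  then show ?case
    by (simp add: chain_prob_False)
next
  case (Suc t)
  have m: "Measurable.pred paths (\<lambda>\<omega>. \<forall>T. occupation_time S T \<omega> < s)" for s
    by (intro pred_intros_countable pred_occupation_less)
  define h where "h z = chain_prob V K z (\<lambda>\<omega>. \<forall>T. occupation_time S T \<omega> < Suc t)" for z
  have step: "h z \<le> (\<Sum>y\<in>V. K z y * chain_prob V K y
      (\<lambda>\<omega>. \<forall>T. occupation_time S T \<omega> < Suc t - of_bool (z \<in> S)))" if "z \<in> V" for z
    unfolding h_def chain_prob_first_step[OF that m]
  proof (intro sum_mono mult_left_mono chain_prob_mono m)
    fix \<omega> :: "nat \<Rightarrow> 'a"
    assume a: "\<forall>T. occupation_time S T (case_nat z \<omega>) < Suc t"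
    show "\<forall>T. occupation_time S T \<omega> < Suc t - of_bool (z \<in> S)"
    proof
      fix T
      show "occupation_time S T \<omega> < Suc t - of_bool (z \<in> S)"
        using a[rule_format, of "Suc T"] by (auto simp: occupation_time_case_nat)
    qed
  qed (use that K_nonneg in auto)
  have "h z \<le> 0"
  proof (rule maximum_principle[OF S _ _ Suc.prems])
    show "h x \<le> (\<Sum>y\<in>V. K x y * h y)" if "x \<in> V - S" for x
      using step[of x] that by (simp add: h_def)
    show "h x \<le> 0" if "x \<in> S" for x
      using step[of x] that S Suc.IH by (auto simp: h_def)
  qed
  then show ?case
    using chain_prob_nonneg by (simp add: h_def antisym)
qed

text \<open>Continuity from above along the decreasing events. It serves to show that some
  \<open>T\<close> is admissible in the definition of \<open>T_prime\<close>.\<close>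

lemma chain_prob_occupation_tendsto_0:
  assumes "S \<subseteq> V" "S \<noteq> {}" and z: "z \<in> V"
  shows "(\<lambda>T. chain_prob V K z (\<lambda>\<omega>. occupation_time S T \<omega> < t)) \<longlonglongrightarrow> 0"
proof -
  let ?A = "\<lambda>T. {\<omega> \<in> space paths. occupation_time S T \<omega> < t}"
  have "(\<lambda>T. measure (chain_law V K z) (?A T)) \<longlonglongrightarrow> measure (chain_law V K z) (\<Inter>T. ?A T)"
  proof (intro finite_measure.finite_Lim_measure_decseq prob_space.finite_measure)
    show "range ?A \<subseteq> sets (chain_law V K z)"
      using pred_occupation_less z by (auto simp: pred_def sets_chain_law)
    show "decseq ?A"
      by (auto simp: decseq_def intro: le_less_trans[OF occupation_time_mono])
  qed (rule prob_space_chain_law[OF z])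
  moreover have "(\<Inter>T. ?A T) = {\<omega> \<in> space paths. \<forall>T. occupation_time S T \<omega> < t}"
    by auto
  ultimately show ?thesis
    using chain_prob_occupation_bounded_eq_0[OF assms, of t] by (simp add: chain_prob_eq[OF z])
qed

text \<open>
  The first \<open>t\<close> visits to \<open>S\<close> are the first \<open>t\<close> states of the trace chain, which starts at the
  first visit to \<open>S\<close>; hence the extension of its survival probabilities to \<open>V - S\<close>.
\<close>

definition visit_survival :: "'a set \<Rightarrow> 'a set \<Rightarrow> nat \<Rightarrow> 'a \<Rightarrow> real" where
  "visit_survival S B t z = (if z \<in> S then survival S (trace_kernel V K S) B t z
     else \<Sum>y\<in>S. trace_kernel V K S z y * survival S (trace_kernel V K S) B t y)"

text \<open>One step of the chain followed by the journey to \<open>S\<close>, if still needed, is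
  exactly one transition by the trace kernel, whether or not \<open>z\<close> lies in
  \<open>S\<close>.\<close>

lemma sum_visit_survival:
  assumes "S \<subseteq> V" "z \<in> V"
  shows "(\<Sum>y\<in>V. K z y * visit_survival S B t y) =
    (\<Sum>y\<in>S. trace_kernel V K S z y * survival S (trace_kernel V K S) B t y)"
proof -
  let ?Q = "trace_kernel V K S" and ?s = "survival S (trace_kernel V K S) B t"
  have "(\<Sum>y\<in>V. K z y * visit_survival S B t y) =
      (\<Sum>y\<in>V - S. \<Sum>v\<in>S. K z y * (?Q y v * ?s v)) + (\<Sum>y\<in>S. K z y * ?s y)"
    using sum.subset_diff[OF assms(1) finite_V, of "\<lambda>y. K z y * visit_survival S B t y"]
    by (simp add: visit_survival_def sum_distrib_left)
  also have "(\<Sum>y\<in>V - S. \<Sum>v\<in>S. K z y * (?Q y v * ?s v)) =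
      (\<Sum>v\<in>S. (\<Sum>y\<in>V - S. K z y * ?Q y v) * ?s v)"
    by (subst sum.swap) (simp add: sum_distrib_right mult.assoc)
  also have "\<dots> + (\<Sum>y\<in>S. K z y * ?s y) = (\<Sum>v\<in>S. ?Q z v * ?s v)"
    using assms by (simp add: trace_kernel_first_step[of S z] sum.distrib[symmetric] algebra_simps)
  finally show ?thesis .
qed

text \<open>Induction on \<open>T\<close> with \<open>t\<close> and \<open>z\<close> free: a step
  from a state of \<open>S\<close> uses up one visit and one step of the trace, a step from
  elsewhere uses up neither. Equality fails in general, as the left-hand side limits the visits to
  time \<open>T\<close> and also demands that \<open>B\<close> be avoided outside
  \<open>S\<close>.\<close>

lemma chain_prob_occupation_avoiding_le:
  assumes S: "S \<subseteq> V" "S \<noteq> {}" and "z \<in> V"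
  shows "chain_prob V K z (\<lambda>\<omega>. t \<le> occupation_time S T \<omega> \<and> (\<forall>u\<le>T. \<omega> u \<notin> B))
    \<le> visit_survival S B t z"
  using \<open>z \<in> V\<close>
proof (induction T arbitrary: t z)
  let ?Q = "trace_kernel V K S"
  let ?E = "\<lambda>T t \<omega>. t \<le> occupation_time S T \<omega> \<and> (\<forall>u\<le>T. \<omega> u \<notin> B)"
  interpret Q: finite_chain S ?Q
    using finite_subset[OF S(1) finite_V] stochastic_trace_kernel[OF S] by unfold_locales
  have nonneg: "0 \<le> visit_survival S B t z" for t z
    by (auto simp: visit_survival_def
        intro!: Q.survival_nonneg sum_nonneg mult_nonneg_nonneg trace_kernel_nonneg)
  have visit_0: "visit_survival S B 0 z = 1" if "z \<in> V" for z
    using that S by (simp add: visit_survival_def sum_trace_kernel)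
  have m: "Measurable.pred paths (?E T t)" for T t
  proof (rule pred_finite_dimensional[of T])
    show "?E T t \<omega> = ?E T t \<omega>'" if "\<And>u. u \<le> T \<Longrightarrow> \<omega> u = \<omega>' u" for \<omega> \<omega>'
      using that occupation_time_cong[of T \<omega> \<omega>' S] by auto
  qed
  {
    case 0
    show ?case
    proof (cases t)
      case 0
      then show ?thesis
        using chain_prob_le_1 visit_0 \<open>z \<in> V\<close> by simp
    next
      case (Suc s)
      show ?thesis
      proof (cases "s = 0 \<and> z \<in> S \<and> z \<notin> B")
        case True
        then have "visit_survival S B t z = 1"
          using Suc Q.sum_K by (simp add: visit_survival_def)
        then show ?thesis
          using chain_prob_le_1 \<open>z \<in> V\<close> by simp
      next
        case False
        then have "chain_prob V K z (?E 0 t) = 0"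
          using chain_prob_first_step[OF \<open>z \<in> V\<close> m[of t 0]] Suc
          by (auto simp: occupation_time_0 chain_prob_False)
        then show ?thesis
          using nonneg by simp
      qed
    qed
  next
    case (Suc T)
    have le_iff: "(\<forall>u\<le>Suc T. case_nat z \<omega> u \<notin> B) \<longleftrightarrow> z \<notin> B \<and> (\<forall>u\<le>T. \<omega> u \<notin> B)" for \<omega>
      using All_less_Suc2[of "Suc T" "\<lambda>u. case_nat z \<omega> u \<notin> B"] by (simp add: less_Suc_eq_le)
    have step: "chain_prob V K z (?E (Suc T) t) = (\<Sum>y\<in>V. K z y * chain_prob V K y
        (\<lambda>\<omega>. t \<le> of_bool (z \<in> S) + occupation_time S T \<omega> \<and> z \<notin> B \<and> (\<forall>u\<le>T. \<omega> u \<notin> B)))"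
      using chain_prob_first_step[OF Suc.prems m[of t "Suc T"]]
      by (simp add: occupation_time_case_nat le_iff)
    have IH: "(\<Sum>y\<in>V. K z y * chain_prob V K y (?E T s)) \<le>
        (\<Sum>y\<in>S. ?Q z y * survival S ?Q B s y)" for s
      unfolding sum_visit_survival[OF S(1) Suc.prems, symmetric]
      using Suc by (intro sum_mono mult_left_mono K_nonneg) auto
    \<comment> \<open>Membership in \<open>B\<close> is treated regardless of \<open>S\<close>: for
      \<open>z\<close> outside \<open>S\<close> the left-hand side vanishes there, while the
      right-hand side may be positive. With \<open>t = 0\<close> no visit is left to be used
      up.\<close>
    consider "z \<in> B" | "z \<notin> B" "z \<notin> S" | "t = 0" | s where "z \<notin> B" "z \<in> S" "t = Suc s"
      by (cases t) auto
    then show ?case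
    proof cases
      case 1
      then show ?thesis
        using step nonneg by (simp add: chain_prob_False)
    next
      case 2
      then show ?thesis
        using step IH[of t] by (simp add: visit_survival_def)
    next
      case 3
      then show ?thesis
        using chain_prob_le_1 visit_0 Suc.prems by simp
    next
      case 4
      then show ?thesis
        using step IH[of s] by (simp add: visit_survival_def)
    qed
  }
qed

lemma visit_survival_le:
  assumes "S \<subseteq> V" "S \<noteq> {}" "z \<in> V"
    and "\<And>y. y \<in> S \<Longrightarrow> survival S (trace_kernel V K S) B t y \<le> q"
  shows "visit_survival S B t z \<le> q"
proof -
  have "(\<Sum>y\<in>S. trace_kernel V K S z y * survival S (trace_kernel V K S) B t y) \<le>
      (\<Sum>y\<in>S. trace_kernel V K S z y * q)"
    using assms by (intro sum_mono mult_left_mono trace_kernel_nonneg)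
  then show ?thesis
    using assms by (simp add: visit_survival_def sum_distrib_right[symmetric] sum_trace_kernel)
qed

end

subsection \<open>Relabelling the states\<close>

lemma transition_prob_image:
  assumes "inj_on f V" and "\<And>x y. x \<in> V \<Longrightarrow> y \<in> V \<Longrightarrow> K' (f x) (f y) = K x y"
    and "x \<in> V" "y \<in> V"
  shows "transition_prob (f ` V) K' t (f x) (f y) = transition_prob V K t x y"
  using assms(3)
proof (induction t arbitrary: x)
  case 0
  then show ?case
    using assms by (auto dest: inj_onD)
next
  case (Suc t)
  then show ?case
    using assms by (simp add: sum.reindex)
qed

lemma survival_image:
  assumes "inj_on f V" and "\<And>x y. x \<in> V \<Longrightarrow> y \<in> V \<Longrightarrow> K' (f x) (f y) = K x y"
    and "A \<subseteq> V" "x \<in> V"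
  shows "survival (f ` V) K' (f ` A) t (f x) = survival V K A t x"
  using assms(4)
proof (induction t arbitrary: x)
  case (Suc t)
  then show ?case
    using assms inj_on_image_mem_iff[OF assms(1) Suc.prems assms(3)] by (simp add: sum.reindex)
qed simp

lemma tv_dist_image:
  assumes f: "inj_on f V"
    and \<mu>: "\<And>x. x \<in> V \<Longrightarrow> \<mu>' (f x) = \<mu> x" and \<nu>: "\<And>x. x \<in> V \<Longrightarrow> \<nu>' (f x) = \<nu> x"
  shows "tv_dist (f ` V) \<mu>' \<nu>' = tv_dist V \<mu> \<nu>"
proof -
  have "(\<Sum>x\<in>f ` A. \<mu>' x) - (\<Sum>x\<in>f ` A. \<nu>' x) = (\<Sum>x\<in>A. \<mu> x) - (\<Sum>x\<in>A. \<nu> x)" if "A \<subseteq> V" for A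
    using that \<mu> \<nu> by (simp add: sum.reindex[OF inj_on_subset[OF f that]] subset_iff)
  then show ?thesis
    unfolding tv_dist_def image_Pow_surj[OF refl, symmetric] image_image
    by (intro arg_cong[where f=Max] image_cong) auto
qed

subsection \<open>Reversible chains\<close>

locale lazy_reversible =
  fixes V :: "'a set" and K :: "'a \<Rightarrow> 'a \<Rightarrow> real" and \<pi> :: "'a \<Rightarrow> real"
  assumes lazy_reversible: "lazy_reversible_chain V K \<pi>"
begin

sublocale irreducible_finite_chain V K
  using lazy_reversible by unfold_locales (auto simp: lazy_reversible_chain_def)

lemma stationary: "stationary V K \<pi>"
  and detailed_balance: "x \<in> V \<Longrightarrow> y \<in> V \<Longrightarrow> \<pi> x * K x y = \<pi> y * K y x"
  and lazy: "x \<in> V \<Longrightarrow> 1 / 2 \<le> K x x"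
  using lazy_reversible by (auto simp: lazy_reversible_chain_def)

lemma sum_stationary: "(\<Sum>x\<in>V. \<pi> x) = 1"
  and stationary_nonneg: "x \<in> V \<Longrightarrow> 0 \<le> \<pi> x"
  and stationary_step: "y \<in> V \<Longrightarrow> (\<Sum>x\<in>V. \<pi> x * K x y) = \<pi> y"
  using stationary by (auto simp: stationary_def)

lemma V_nonempty: "V \<noteq> {}"
  using sum_stationary by auto

lemma stationary_transition_prob:
  "y \<in> V \<Longrightarrow> (\<Sum>x\<in>V. \<pi> x * transition_prob V K t x y) = \<pi> y"
proof (induction t)
  case 0
  have "(\<Sum>x\<in>V. \<pi> x * of_bool (x = y)) = (\<Sum>x\<in>V. if x = y then \<pi> x else 0)"
    by (intro sum.cong) auto
  then show ?case
    using 0 finite_V by simp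
next
  case (Suc t)
  have "(\<Sum>x\<in>V. \<pi> x * transition_prob V K (Suc t) x y) =
      (\<Sum>w\<in>V. (\<Sum>x\<in>V. \<pi> x * K x w) * transition_prob V K t w y)"
    unfolding transition_prob.simps sum_distrib_left sum_distrib_right
    by (subst sum.swap) (simp add: mult.assoc)
  then show ?case
    using Suc by (simp add: stationary_step)
qed

lemma stationary_pos:
  assumes "y \<in> V"
  shows "0 < \<pi> y"
proof -
  obtain x where x: "x \<in> V" "0 < \<pi> x"
    using sum_stationary sum_nonpos[of V \<pi>] by (force simp: not_le[symmetric])
  obtain t where "0 < transition_prob V K t x y"
    using transition_prob_pos[OF x(1) assms] by auto
  then have "0 < \<pi> x * transition_prob V K t x y"
    using x by simp
  also have "\<dots> \<le> (\<Sum>x\<in>V. \<pi> x * transition_prob V K t x y)"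
    using x finite_V
    by (intro member_le_sum) (auto intro!: mult_nonneg_nonneg stationary_nonneg transition_prob_nonneg)
  finally show ?thesis
    using stationary_transition_prob[OF assms] by simp
qed

text \<open>Detailed balance makes the density of \<open>\<mu>\<close> with respect to
  \<open>\<pi>\<close> harmonic. The maximum principle, with the single state where the density is
  minimal as the set \<open>S\<close>, shows that it is constant; normalisation makes the constant
  1.\<close>

lemma stationary_unique:
  assumes "stationary V K \<mu>"
  shows "\<mu> = \<pi>"
proof -
  define h where "h x = \<mu> x / \<pi> x" for x
  have harmonic: "h x = (\<Sum>y\<in>V. K x y * h y)" if "x \<in> V" for x
  proof -
    have "(\<Sum>y\<in>V. K x y * h y) = (\<Sum>y\<in>V. \<mu> y * K y x / \<pi> x)"
    proof (rule sum.cong)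
      fix y assume "y \<in> V"
      then have "K x y = \<pi> y * K y x / \<pi> x" and "\<pi> y \<noteq> 0"
        using detailed_balance[OF that, of y] stationary_pos[OF that] stationary_pos[of y]
        by (simp_all add: eq_divide_eq mult.commute)
      then show "K x y * h y = \<mu> y * K y x / \<pi> x"
        by (simp add: h_def)
    qed simp
    also have "\<dots> = h x"
      using assms that by (simp add: stationary_def h_def flip: sum_divide_distrib)
    finally show ?thesis ..
  qed
  have "Min (h ` V) \<in> h ` V"
    using finite_V V_nonempty by (intro Min_in) auto
  then obtain s where s: "s \<in> V" "h s = Min (h ` V)"
    by auto
  have const: "h x = h s" if "x \<in> V" for x
  proof (rule antisym)
    show "h x \<le> h s"
    proof (rule maximum_principle[of "{s}", OF _ _ _ _ that])
      show "h y \<le> (\<Sum>w\<in>V. K y w * h w)" if "y \<in> V - {s}" for y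
        using harmonic[of y] that by simp
    qed (use s in auto)
    show "h s \<le> h x"
      using finite_V that by (simp add: s)
  qed
  have eq: "\<mu> x = h s * \<pi> x" if "x \<in> V" for x
    using const[OF that] stationary_pos[OF that] by (simp add: h_def[of x] field_simps)
  have "h s = (\<Sum>x\<in>V. h s * \<pi> x)"
    by (simp add: sum_distrib_left[symmetric] sum_stationary)
  also have "\<dots> = 1"
    using assms eq by (simp add: stationary_def)
  finally have "\<mu> x = \<pi> x" if "x \<in> V" for x
    using eq[OF that] by simp
  moreover have "\<mu> x = \<pi> x" if "x \<notin> V" for x
    using assms stationary that by (simp add: stationary_def)
  ultimately show ?thesis
    by blast
qed

lemma stationary_dist_eq: "stationary_dist V K = \<pi>"
  unfolding stationary_dist_def using stationary stationary_unique by (rule the_equality)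

text \<open>Detailed balance is applied to each step of an excursion; the reversed excursion has the
  same intermediate states, so the taboo is unaffected. The first step on one side matches the last
  step on the other.\<close>

lemma first_passage_reversal:
  assumes "x \<in> V" "y \<in> V"
  shows "\<pi> x * first_passage V K S t x y = \<pi> y * first_passage V K S t y x"
  using assms(1)
proof (induction t arbitrary: x)
  case 0
  then show ?case
    using assms(2) by (simp add: detailed_balance)
next
  case (Suc t)
  have "\<pi> x * first_passage V K S (Suc t) x y =
      (\<Sum>w\<in>V - S. \<pi> x * K x w * first_passage V K S t w y)"
    by (simp add: sum_distrib_left mult.assoc)
  also have "\<dots> = (\<Sum>w\<in>V - S. \<pi> y * (first_passage V K S t y w * K w x))"
  proof (rule sum.cong)
    fix w assume "w \<in> V - S"
    then have "\<pi> x * K x w * first_passage V K S t w y =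
        K w x * (\<pi> w * first_passage V K S t w y)"
      using detailed_balance[of x w] Suc.prems by simp
    also have "\<dots> = \<pi> y * (first_passage V K S t y w * K w x)"
      using Suc.IH[of w] \<open>w \<in> V - S\<close> by simp
    finally show "\<pi> x * K x w * first_passage V K S t w y =
        \<pi> y * (first_passage V K S t y w * K w x)" .
  qed simp
  also have "\<dots> = \<pi> y * first_passage V K S (Suc t) y x"
    by (simp only: first_passage_last_step sum_distrib_left)
  finally show ?case .
qed

lemma trace_kernel_reversible:
  assumes "S \<subseteq> V" "x \<in> S" "y \<in> S"
  shows "\<pi> x * trace_kernel V K S x y = \<pi> y * trace_kernel V K S y x"
proof (rule sums_unique2)
  show "(\<lambda>t. \<pi> x * first_passage V K S t x y) sums (\<pi> x * trace_kernel V K S x y)"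
    using assms by (intro sums_mult first_passage_sums) auto
  have "(\<lambda>t. \<pi> y * first_passage V K S t y x) sums (\<pi> y * trace_kernel V K S y x)"
    using assms by (intro sums_mult first_passage_sums) auto
  then show "(\<lambda>t. \<pi> x * first_passage V K S t x y) sums (\<pi> y * trace_kernel V K S y x)"
    using assms by (subst first_passage_reversal) auto
qed

text \<open>Reversibility summed over \<open>S\<close> gives stationarity of the normalised
  restriction of \<open>\<pi>\<close>. Laziness is inherited since staying put is already a return
  to \<open>S\<close>.\<close>

lemma lazy_reversible_trace:
  assumes S: "S \<subseteq> V" "S \<noteq> {}"
  shows "lazy_reversible_chain S (trace_kernel V K S)
    (\<lambda>x. if x \<in> S then \<pi> x / (\<Sum>y\<in>S. \<pi> y) else 0)"
proof -
  have fin: "finite S"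
    using finite_subset[OF S(1) finite_V] .
  have pos: "0 < (\<Sum>y\<in>S. \<pi> y)"
    using S fin stationary_pos by (intro sum_pos) auto
  have "(\<Sum>x\<in>S. \<pi> x * trace_kernel V K S x y) = \<pi> y" if "y \<in> S" for y
  proof -
    have "(\<Sum>x\<in>S. \<pi> x * trace_kernel V K S x y) = (\<Sum>x\<in>S. \<pi> y * trace_kernel V K S y x)"
      using that S by (intro sum.cong trace_kernel_reversible) auto
    then show ?thesis
      using that S by (simp add: sum_distrib_left[symmetric] sum_trace_kernel subset_iff)
  qed
  then have "stationary S (trace_kernel V K S) (\<lambda>x. if x \<in> S then \<pi> x / (\<Sum>y\<in>S. \<pi> y) else 0)"
    using pos S stationary_nonneg
    by (auto simp: stationary_def sum_divide_distrib[symmetric] intro!: divide_nonneg_pos)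
  moreover have "1 / 2 \<le> trace_kernel V K S x x" if "x \<in> S" for x
    using lazy[of x] trace_kernel_ge[of S x x] that S by force
  moreover have "\<pi> x / (\<Sum>y\<in>S. \<pi> y) * trace_kernel V K S x y =
      \<pi> y / (\<Sum>y\<in>S. \<pi> y) * trace_kernel V K S y x" if "x \<in> S" "y \<in> S" for x y
    using trace_kernel_reversible[OF S(1) that] by simp
  ultimately show ?thesis
    using fin S stochastic_trace_kernel irreducible_trace_kernel
    by (simp add: lazy_reversible_chain_def)
qed

lemma finite_hitting_times:
  "finite {expected_hitting_time V K z A | z A. z \<in> V \<and> A \<subseteq> V \<and> (\<Sum>x\<in>A. \<pi> x) \<ge> \<alpha>}"
  by (rule finite_subset[of _ "(\<lambda>(z, A). expected_hitting_time V K z A) ` (V \<times> Pow V)"])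
    (use finite_V in auto)

lemma expected_le_max_hitting_time:
  "z \<in> V \<Longrightarrow> A \<subseteq> V \<Longrightarrow> \<alpha> \<le> (\<Sum>x\<in>A. \<pi> x) \<Longrightarrow>
    expected_hitting_time V K z A \<le> max_hitting_time V K \<pi> \<alpha>"
  unfolding max_hitting_time_def by (intro Max_ge finite_hitting_times) auto

lemma max_hitting_time_le:
  assumes "\<alpha> \<le> 1"
    and "\<And>z A. z \<in> V \<Longrightarrow> A \<subseteq> V \<Longrightarrow> \<alpha> \<le> (\<Sum>x\<in>A. \<pi> x) \<Longrightarrow> expected_hitting_time V K z A \<le> b"
  shows "max_hitting_time V K \<pi> \<alpha> \<le> b"
proof -
  obtain z where "z \<in> V"
    using V_nonempty by auto
  \<comment> \<open>The target \<open>A = V\<close> shows that the maximum ranges over a nonempty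
    set.\<close>
  then have "expected_hitting_time V K z V \<in>
      {expected_hitting_time V K z A | z A. z \<in> V \<and> A \<subseteq> V \<and> (\<Sum>x\<in>A. \<pi> x) \<ge> \<alpha>}"
    using assms(1) sum_stationary by (intro CollectI exI[of _ z] exI[of _ V]) simp
  then show ?thesis
    unfolding max_hitting_time_def
    by (intro Max.boundedI[OF finite_hitting_times]) (auto intro: assms(2))
qed

end

subsection \<open>Hitting and mixing times\<close>

lemma lazy_reversible_chain_image:
  assumes "lazy_reversible_chain V K \<pi>" and f: "inj_on f V"
    and K': "\<And>x y. x \<in> V \<Longrightarrow> y \<in> V \<Longrightarrow> K' (f x) (f y) = K x y"
    and \<pi>': "\<And>x. x \<in> V \<Longrightarrow> \<pi>' (f x) = \<pi> x" "\<And>a. a \<notin> f ` V \<Longrightarrow> \<pi>' a = 0"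
  shows "lazy_reversible_chain (f ` V) K' \<pi>'"
proof -
  interpret lazy_reversible V K \<pi>
    by unfold_locales fact
  have fin: "finite (f ` V)"
    using finite_V by simp
  have stoch: "stochastic (f ` V) K'"
    using f K' by (simp add: stochastic_def sum.reindex K_nonneg sum_K)
  interpret I: finite_chain "f ` V" K'
    using fin stoch by unfold_locales
  have "irreducible_chain (f ` V) K'"
    unfolding irreducible_chain_def
  proof (intro ballI)
    fix a b assume "a \<in> f ` V" "b \<in> f ` V"
    then obtain x y where xy: "x \<in> V" "y \<in> V" "a = f x" "b = f y"
      by auto
    then obtain t where "0 < transition_prob V K t x y"
      using transition_prob_pos by blast
    then show "\<exists>t. chain_prob (f ` V) K' a (\<lambda>\<omega>. \<omega> t = b) > 0"
      using xy transition_prob_image[where K = K and K' = K', OF f K' xy(1,2)]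
      by (auto simp: I.chain_prob_eq_transition_prob)
  qed
  moreover have "stationary (f ` V) K' \<pi>'"
    using f K' \<pi>'
    by (simp add: stationary_def sum.reindex stationary_nonneg sum_stationary stationary_step)
  ultimately show ?thesis
    using fin stoch K' \<pi>' lazy detailed_balance by (simp add: lazy_reversible_chain_def)
qed

text \<open>The constants are quantified over chains on natural numbers, so the chain is carried
  along an injection \<open>f\<close>. Mixing and hitting times are determined by transition and
  survival probabilities and \<open>\<pi>\<close>, all of which \<open>f\<close> preserves.\<close>

lemma mixing_hitting_constantsD:
  assumes const: "mixing_hitting_constants \<beta> c c'"
    and chain: "lazy_reversible_chain V K \<pi>" and card: "card V \<ge> 2"
  shows "ennreal c' * max_hitting_time V K \<pi> \<beta> \<le> of_nat (mixing_time V K)"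
    and "of_nat (mixing_time V K) \<le> ennreal c * max_hitting_time V K \<pi> \<beta>"
proof -
  interpret lazy_reversible V K \<pi>
    by unfold_locales fact
  obtain f :: "'a \<Rightarrow> nat" where f: "inj_on f V"
    using finite_imp_inj_to_nat_seg[OF finite_V] by auto
  define g where "g = inv_into V f"
  define K' where "K' a b = K (g a) (g b)" for a b
  define \<pi>' where "\<pi>' a = (if a \<in> f ` V then \<pi> (g a) else 0)" for a
  have gf: "g (f x) = x" if "x \<in> V" for x
    using f that by (simp add: g_def)
  have K': "K' (f x) (f y) = K x y" if "x \<in> V" "y \<in> V" for x y
    using that by (simp add: K'_def gf)
  have \<pi>': "\<pi>' (f x) = \<pi> x" if "x \<in> V" for x
    using that by (simp add: \<pi>'_def gf)
  have chain': "lazy_reversible_chain (f ` V) K' \<pi>'"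
    using chain f K' \<pi>' by (rule lazy_reversible_chain_image) (simp_all add: \<pi>'_def)
  interpret I: lazy_reversible "f ` V" K' \<pi>'
    by unfold_locales fact
  have "tv_dist (f ` V) (\<lambda>b. chain_prob (f ` V) K' (f x) (\<lambda>\<omega>. \<omega> t = b)) (stationary_dist (f ` V) K') =
      tv_dist V (\<lambda>y. chain_prob V K x (\<lambda>\<omega>. \<omega> t = y)) (stationary_dist V K)" if "x \<in> V" for x t
    using that \<pi>' transition_prob_image[where K = K and K' = K', OF f K' that]
    by (intro tv_dist_image[OF f])
      (simp_all add: I.chain_prob_eq_transition_prob chain_prob_eq_transition_prob
        I.stationary_dist_eq stationary_dist_eq)
  then have mixing: "mixing_time (f ` V) K' = mixing_time V K"
    by (simp add: mixing_time_def image_image cong: image_cong_simp)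
  have mass: "(\<Sum>a\<in>f ` A. \<pi>' a) = (\<Sum>x\<in>A. \<pi> x)" if "A \<subseteq> V" for A
    using that \<pi>' by (simp add: sum.reindex[OF inj_on_subset[OF f that]] subset_iff)
  have hitting: "expected_hitting_time (f ` V) K' (f x) (f ` A) = expected_hitting_time V K x A"
    if "x \<in> V" "A \<subseteq> V" for x A
    using that survival_image[where K = K and K' = K', OF f K' that(2,1)]
    by (simp add: expected_hitting_time_eq I.expected_hitting_time_eq del: survival.simps)
  have "{expected_hitting_time (f ` V) K' z A | z A.
      z \<in> f ` V \<and> A \<subseteq> f ` V \<and> (\<Sum>x\<in>A. \<pi>' x) \<ge> \<beta>} =
    {expected_hitting_time V K z A | z A. z \<in> V \<and> A \<subseteq> V \<and> (\<Sum>x\<in>A. \<pi> x) \<ge> \<beta>}" (is "?l = ?r")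
  proof (intro equalityI subsetI)
    fix e assume "e \<in> ?l"
    then obtain x A where xA: "x \<in> V" "A \<subseteq> f ` V" "(\<Sum>x\<in>A. \<pi>' x) \<ge> \<beta>"
      "e = expected_hitting_time (f ` V) K' (f x) A"
      by auto
    moreover obtain B where "B \<subseteq> V" "A = f ` B"
      using xA(2) by (rule subset_imageE)
    ultimately show "e \<in> ?r"
      using mass[of B] hitting[of x B] by (intro CollectI exI[of _ x] exI[of _ B]) simp
  next
    fix e assume "e \<in> ?r"
    then obtain x A where "x \<in> V" "A \<subseteq> V" "(\<Sum>x\<in>A. \<pi> x) \<ge> \<beta>"
      "e = expected_hitting_time V K x A"
      by auto
    then show "e \<in> ?l"
      using mass[of A] hitting[of x A]
      by (intro CollectI exI[of _ "f x"] exI[of _ "f ` A"]) (simp add: image_mono)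
  qed
  then have "max_hitting_time (f ` V) K' \<pi>' \<beta> = max_hitting_time V K \<pi> \<beta>"
    by (simp add: max_hitting_time_def)
  moreover have "card (f ` V) \<ge> 2"
    using card f by (simp add: card_image)
  ultimately show "ennreal c' * max_hitting_time V K \<pi> \<beta> \<le> of_nat (mixing_time V K)"
    and "of_nat (mixing_time V K) \<le> ennreal c * max_hitting_time V K \<pi> \<beta>"
    using const chain' mixing unfolding mixing_hitting_constants_def by metis+
qed

text \<open>\<open>X\<close> will be a maximal hitting time, possibly infinite a priori. Only a real
  lower bound \<open>s\<close>, a partial sum of tail probabilities, is converted.\<close>

lemma ennreal_mult_le_of_natD:
  assumes "ennreal c * X \<le> of_nat m" and "ennreal s \<le> X" and "0 < c" "0 \<le> s"
  shows "c * s \<le> real m"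
proof -
  have "ennreal (c * s) = ennreal c * ennreal s"
    using assms by (simp add: ennreal_mult)
  also have "\<dots> \<le> ennreal c * X"
    using assms(2) by (rule mult_left_mono) simp
  also have "\<dots> \<le> ennreal (real m)"
    using assms(1) by (simp add: ennreal_of_nat_eq_real_of_nat)
  finally show ?thesis
    by (simp add: ennreal_le_iff)
qed

context lazy_reversible
begin

lemma sum_survival_le_expected_hitting_time:
  assumes "x \<in> V"
  shows "ennreal (\<Sum>j<N. survival V K A (Suc j) x) \<le> expected_hitting_time V K x A"
proof -
  have "ennreal (\<Sum>j<N. survival V K A (Suc j) x) = (\<Sum>j<N. ennreal (survival V K A (Suc j) x))"
    using survival_nonneg[OF assms] by (intro sum_ennreal[symmetric])
  then show ?thesis
    unfolding expected_hitting_time_eq[OF assms] by (simp only:) (intro sum_le_suminf; simp)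
qed

lemma sum_survival_le_mixing_time:
  assumes const: "mixing_hitting_constants \<beta> c c'" and "card V \<ge> 2"
    and "A \<subseteq> V" "\<beta> \<le> (\<Sum>x\<in>A. \<pi> x)" and x: "x \<in> V"
  shows "c' * (\<Sum>j<N. survival V K A (Suc j) x) \<le> real (mixing_time V K)"
proof (rule ennreal_mult_le_of_natD)
  show "ennreal c' * max_hitting_time V K \<pi> \<beta> \<le> of_nat (mixing_time V K)"
    using const lazy_reversible assms(2) by (rule mixing_hitting_constantsD(1))
  show "ennreal (\<Sum>j<N. survival V K A (Suc j) x) \<le> max_hitting_time V K \<pi> \<beta>"
    using sum_survival_le_expected_hitting_time[OF x]
      expected_le_max_hitting_time[OF x assms(3,4)] by (rule order_trans)
  show "0 < c'"
    using const by (simp add: mixing_hitting_constants_def)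
  show "0 \<le> (\<Sum>j<N. survival V K A (Suc j) x)"
    using survival_nonneg[OF x] by (rule sum_nonneg)
qed

text \<open>
  \<open>mixing_time\<close> is an unspecified number if no \<open>t\<close> satisfies its defining condition, so its
  positivity needs an argument: the lower bound by hitting times excludes the value 0.
\<close>

lemma mixing_time_pos:
  assumes const: "\<And>\<beta>. 0 < \<beta> \<Longrightarrow> \<beta> < 1 / 2 \<Longrightarrow> mixing_hitting_constants \<beta> (c \<beta>) (c' \<beta>)"
  shows "mixing_time V K > 0"
proof (cases "card V \<ge> 2")
  case True
  then obtain y x where xy: "y \<in> V" "x \<in> V" "x \<noteq> y"
    by (metis card_2_iff' card_le_Suc0_iff_eq finite_V not_less_eq_eq numeral_2_eq_2)
  \<comment> \<open>At this level the target consisting of \<open>y\<close> alone is heavy enough,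
    and its hitting time from \<open>x\<close> is at least 1.\<close>
  define \<beta> where "\<beta> = min (1 / 4) (\<pi> y)"
  have \<beta>: "mixing_hitting_constants \<beta> (c \<beta>) (c' \<beta>)"
    using stationary_pos[OF xy(1)] by (intro const) (auto simp: \<beta>_def)
  have "c' \<beta> * (\<Sum>j<1. survival V K {y} (Suc j) x) \<le> real (mixing_time V K)"
    using xy by (intro sum_survival_le_mixing_time[OF \<beta> True]) (auto simp: \<beta>_def)
  moreover have "(\<Sum>j<1. survival V K {y} (Suc j) x) = 1"
    using xy by (simp add: sum_K)
  moreover have "0 < c' \<beta>"
    using \<beta> by (simp add: mixing_hitting_constants_def)
  ultimately show ?thesis
    by simp
next
  \<comment> \<open>A single state is outside the scope of the constants; here time 1 satisfies the
    defining condition of the mixing time, so the least such time is positive.\<close>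
  case False
  then obtain x where V: "V = {x}"
    using V_nonempty finite_V by (metis card_1_singletonE card_gt_0_iff less_2_cases not_le not_gr0 One_nat_def)
  have "K x x = 1" "\<pi> x = 1"
    using sum_K[of x] sum_stationary by (auto simp: V)
  have "x \<in> V"
    using V by simp
  have "chain_prob V K x (\<lambda>\<omega>. \<omega> 1 = x) = 1"
    unfolding chain_prob_eq_transition_prob[OF \<open>x \<in> V\<close>] using \<open>K x x = 1\<close> by (simp add: V)
  moreover have "stationary_dist V K x = 1"
    unfolding stationary_dist_eq by fact
  ultimately have "tv_dist V (\<lambda>y. chain_prob V K x (\<lambda>\<omega>. \<omega> 1 = y)) (stationary_dist V K) = 0"
    by (simp add: tv_dist_def Pow_insert V)
  then have "(1 :: nat) > 0 \<and> Max ((\<lambda>x. tv_dist V (\<lambda>y. chain_prob V K x (\<lambda>\<omega>. \<omega> 1 = y))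
      (stationary_dist V K)) ` V) < 1 / 4"
    using V by simp
  then show ?thesis
    unfolding mixing_time_def by (rule LeastI2) auto
qed

text \<open>The constants require two states. If \<open>B\<close> covers \<open>V\<close>, then
  \<open>B\<close> cannot be avoided for \<open>t > 0\<close> steps; otherwise there are states
  inside and outside \<open>B\<close>, and these are distinct.\<close>

lemma survival_le_exp_mixing_time:
  assumes const: "mixing_hitting_constants \<beta> c c'" and "0 < \<beta>" and "mixing_time V K > 0"
    and B: "\<beta> \<le> (\<Sum>x\<in>B \<inter> V. \<pi> x)" and x: "x \<in> V" and "t > 0"
  shows "survival V K B t x \<le> exp (- real_of_int \<lfloor>c' * real t / (exp 1 * real (mixing_time V K))\<rfloor>)"
proof (cases "V \<subseteq> B")
  case True
  then have "survival V K B t x = 0"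
    using x \<open>t > 0\<close> by (cases t) auto
  then show ?thesis
    by simp
next
  case False
  then obtain x0 where x0: "x0 \<in> V" "x0 \<notin> B"
    by auto
  have "B \<inter> V \<noteq> {}"
    using B \<open>0 < \<beta>\<close> by auto
  then obtain y where y: "y \<in> V" "y \<noteq> x0"
    using x0 by auto
  have "card {x0, y} \<le> card V"
    using x0 y finite_V by (intro card_mono) auto
  then have card: "card V \<ge> 2"
    using y by simp
  have c': "0 < c'"
    using const by (simp add: mixing_hitting_constants_def)
  define H where "H = real (mixing_time V K) / c'"
  have H: "(\<Sum>j<N. survival V K (B \<inter> V) (Suc j) y) \<le> H" if "y \<in> V" for y N
    using sum_survival_le_mixing_time[OF const card _ B that, of N] c'
    by (simp add: H_def field_simps del: survival.simps)
  \<comment> \<open>From \<open>x0\<close> outside \<open>B\<close> at least one step is needed.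
    This bound yields \<open>k \<le> t\<close> below.\<close>
  have "1 \<le> H"
    using H[OF x0(1), of 1] x0 by (simp add: sum_K)
  define k where "k = nat \<lfloor>c' * real t / (exp 1 * real (mixing_time V K))\<rfloor>"
  have nonneg: "0 \<le> c' * real t / (exp 1 * real (mixing_time V K))"
    using c' by simp
  then have k: "real k = real_of_int \<lfloor>c' * real t / (exp 1 * real (mixing_time V K))\<rfloor>"
    by (simp add: k_def)
  have k_le: "real k \<le> real t / (exp 1 * H)"
    unfolding k using c' by (simp add: H_def) (metis mult.commute of_int_floor_le times_divide_eq_left)
  also have "\<dots> \<le> real t / 1"
    using \<open>1 \<le> H\<close> mult_mono[of 1 "exp (1 :: real)" 1 H] by (intro divide_left_mono) auto
  finally have "k \<le> t"
    by simp
  have "survival V K (B \<inter> V) t x \<le> exp (- real k)"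
    using \<open>1 \<le> H\<close> by (intro survival_le_exp[OF H _ x k_le \<open>k \<le> t\<close>]) auto
  then show ?thesis
    using x by (simp add: survival_Int k)
qed

lemma visit_survival_le_exp:
  assumes const: "\<And>\<beta>. 0 < \<beta> \<Longrightarrow> \<beta> < 1 / 2 \<Longrightarrow> mixing_hitting_constants \<beta> (c \<beta>) (c' \<beta>)"
    and S: "S \<subseteq> V" "S \<noteq> {}" and "z \<in> V" and "t > 0" and \<beta>: "0 < \<beta>" "\<beta> < 1 / 2"
    and A: "\<beta> * (\<Sum>x\<in>S. \<pi> x) \<le> (\<Sum>x\<in>A \<inter> S. \<pi> x)"
  shows "visit_survival S A t z \<le>
    exp (- real_of_int \<lfloor>c' \<beta> * real t / (exp 1 * real (mixing_time S (trace_kernel V K S)))\<rfloor>)"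
proof -
  let ?\<pi> = "\<lambda>x. if x \<in> S then \<pi> x / (\<Sum>y\<in>S. \<pi> y) else 0"
  interpret Q: lazy_reversible S "trace_kernel V K S" ?\<pi>
    using lazy_reversible_trace[OF S] by unfold_locales
  have pos: "0 < (\<Sum>y\<in>S. \<pi> y)"
    using S Q.finite_V stationary_pos by (intro sum_pos) auto
  have "(\<Sum>x\<in>A \<inter> S. ?\<pi> x) = (\<Sum>x\<in>A \<inter> S. \<pi> x) / (\<Sum>y\<in>S. \<pi> y)"
    by (simp add: sum_divide_distrib)
  also have "\<beta> \<le> \<dots>"
    using A pos by (simp add: field_simps)
  finally have "\<beta> \<le> (\<Sum>x\<in>A \<inter> S. ?\<pi> x)" .
  then show ?thesis
    using Q.mixing_time_pos[OF const] \<open>t > 0\<close> \<beta>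
    by (intro visit_survival_le[OF S \<open>z \<in> V\<close>] Q.survival_le_exp_mixing_time[OF const]) auto
qed

lemma survival_le_occupation:
  assumes z: "z \<in> V" and I: "finite I" and P: "\<And>i. i \<in> I \<Longrightarrow> P i \<subseteq> V" "\<And>i. i \<in> I \<Longrightarrow> P i \<noteq> {}"
  shows "survival V K A (Suc T) z \<le>
    chain_prob V K z (\<lambda>\<omega>. \<forall>i\<in>I. occupation_time (P i) T \<omega> < t) +
    (\<Sum>i\<in>I. visit_survival (P i) A t z)"
proof -
  let ?E = "\<lambda>\<omega>. \<forall>i\<in>I. occupation_time (P i) T \<omega> < t"
  let ?F = "\<lambda>i \<omega>. t \<le> occupation_time (P i) T \<omega> \<and> (\<forall>u\<le>T. \<omega> u \<notin> A)"
  have mE: "Measurable.pred paths ?E"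
    using I pred_occupation_less by (intro pred_intros_finite)
  have avoid: "Measurable.pred paths (\<lambda>\<omega>. \<forall>u\<le>T. \<omega> u \<notin> A)"
    by measurable
  have mF: "Measurable.pred paths (?F i)" for i
    unfolding not_less[symmetric, of t]
    by (intro pred_intros_logic pred_occupation_less avoid)
  have mF': "Measurable.pred paths (\<lambda>\<omega>. \<exists>i\<in>I. ?F i \<omega>)"
    using I mF by (intro pred_intros_finite)
  have "survival V K A (Suc T) z = chain_prob V K z (\<lambda>\<omega>. \<forall>u<Suc T. \<omega> u \<notin> A)"
    by (rule chain_prob_eq_survival[OF z, symmetric])
  also have "\<dots> \<le> chain_prob V K z (\<lambda>\<omega>. ?E \<omega> \<or> (\<exists>i\<in>I. ?F i \<omega>))"
    using mE mF' by (intro chain_prob_mono[OF z] pred_intros_logic) (auto simp: not_less less_Suc_eq_le)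
  also have "\<dots> \<le> chain_prob V K z ?E + chain_prob V K z (\<lambda>\<omega>. \<exists>i\<in>I. ?F i \<omega>)"
    using z mE mF' by (rule chain_prob_disj_le)
  also have "chain_prob V K z (\<lambda>\<omega>. \<exists>i\<in>I. ?F i \<omega>) \<le> (\<Sum>i\<in>I. chain_prob V K z (?F i))"
    using z I mF by (rule chain_prob_Bex_le)
  also have "\<dots> \<le> (\<Sum>i\<in>I. visit_survival (P i) A t z)"
    using P z by (intro sum_mono chain_prob_occupation_avoiding_le)
  finally show ?thesis
    by simp
qed

end

subsection \<open>The time scale of the partition\<close>

lemma (in lazy_reversible) mixing_time_le_of_survival:
  assumes const: "mixing_hitting_constants \<alpha> c c'" and "card V \<ge> 2" and "\<alpha> \<le> 1" and "T > 0"
    and surv: "\<And>A z. A \<subseteq> V \<Longrightarrow> \<alpha> \<le> (\<Sum>x\<in>A. \<pi> x) \<Longrightarrow> z \<in> V \<Longrightarrow> survival V K A (Suc T) z \<le> 1 / 4"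
  shows "real (mixing_time V K) \<le> 4 / 3 * c * real T"
proof -
  have c: "0 < c"
    using const by (simp add: mixing_hitting_constants_def)
  have "expected_hitting_time V K z A \<le> ennreal (4 / 3 * real T)"
    if "z \<in> V" "A \<subseteq> V" "\<alpha> \<le> (\<Sum>x\<in>A. \<pi> x)" for z A
    unfolding expected_hitting_time_eq[OF that(1)]
  proof (rule suminf_le_const[OF summableI])
    fix N
    have "(\<Sum>j<N. ennreal (survival V K A (Suc j) z)) = ennreal (\<Sum>j<N. survival V K A (Suc j) z)"
      using survival_nonneg[OF that(1)] by (intro sum_ennreal)
    also have "\<dots> \<le> ennreal (4 / 3 * real T)"
      using surv[OF that(2,3)] that(1) \<open>T > 0\<close> by (intro ennreal_leI sum_survival_le)
    finally show "(\<Sum>j<N. ennreal (survival V K A (Suc j) z)) \<le> ennreal (4 / 3 * real T)" .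
  qed
  then have "max_hitting_time V K \<pi> \<alpha> \<le> ennreal (4 / 3 * real T)"
    using \<open>\<alpha> \<le> 1\<close> by (rule max_hitting_time_le[rotated])
  then have "ennreal c * max_hitting_time V K \<pi> \<alpha> \<le> ennreal c * ennreal (4 / 3 * real T)"
    by (rule mult_left_mono) simp
  also have "\<dots> = ennreal (4 / 3 * c * real T)"
    using c by (simp add: ennreal_mult[symmetric] mult_ac)
  finally have "ennreal (real (mixing_time V K)) \<le> ennreal (4 / 3 * c * real T)"
    using mixing_hitting_constantsD(2)[OF const lazy_reversible \<open>card V \<ge> 2\<close>]
    by (simp add: ennreal_of_nat_eq_real_of_nat)
  then show ?thesis
    using c by (simp add: ennreal_le_iff)
qed

lemma floor_exp_tendsto_0:
  assumes "0 < (r :: real)"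
  shows "(\<lambda>t. exp (- real_of_int \<lfloor>r * real t\<rfloor>)) \<longlonglongrightarrow> 0"
proof (rule tendsto_sandwich[of "\<lambda>_. 0"])
  show "\<forall>\<^sub>F t in sequentially. exp (- real_of_int \<lfloor>r * real t\<rfloor>) \<le> exp (1 - r * real t)"
    by (intro always_eventually allI) (simp, linarith)
  show "(\<lambda>t. exp (1 - r * real t)) \<longlonglongrightarrow> 0"
    using assms by real_asymp
qed auto

theorem lemma2p2:
  fixes \<Omega> :: "'a set" and K :: "'a \<Rightarrow> 'a \<Rightarrow> real" and \<pi> :: "'a \<Rightarrow> real"
    and n :: nat and P :: "nat \<Rightarrow> 'a set"
    and c c' :: "real \<Rightarrow> real" and \<alpha> :: real
  assumes "\<And>\<beta>. 0 < \<beta> \<Longrightarrow> \<beta> < 1 / 2 \<Longrightarrow> mixing_hitting_constants \<beta> (c \<beta>) (c' \<beta>)"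
    and "lazy_reversible_chain \<Omega> K \<pi>" and "card \<Omega> \<ge> 2"
    and "is_partition \<Omega> n P"
    and "0 < \<alpha>" and "\<alpha> < 1 / 2"
  shows "real (mixing_time \<Omega> K) \<le> 4 / 3 * c \<alpha> * real (T_prime \<Omega> K \<pi> n P \<alpha> (c' (\<alpha> / 2)))"
proof -
  interpret lazy_reversible \<Omega> K \<pi>
    by unfold_locales fact
  define \<beta> where "\<beta> = \<alpha> / 2"
  have \<beta>: "0 < \<beta>" "\<beta> < 1 / 2" "\<alpha> = 2 * \<beta>"
    using assms(5,6) by (auto simp: \<beta>_def)
  have P: "(\<Union>i\<in>{1..n}. P i) = \<Omega>" "disjoint_family_on P {1..n}"
    using assms(4) by (auto simp: is_partition_def)
  have P_sub: "P i \<subseteq> \<Omega>" and P_ne: "P i \<noteq> {}" if "i \<in> {1..n}" for i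
    using assms(4) that by (auto simp: is_partition_def)
  have P_fin: "finite (P i)" if "i \<in> {1..n}" for i
    using finite_subset[OF P_sub[OF that] finite_V] .
  have mass_UN: "(\<Sum>x\<in>(\<Union>i\<in>I. P i). \<pi> x) = (\<Sum>i\<in>I. \<Sum>x\<in>P i. \<pi> x)" if "I \<subseteq> {1..n}" for I
  proof (rule sum.UNION_disjoint)
    show "finite I"
      using that by (rule finite_subset) simp
    show "\<forall>i\<in>I. finite (P i)"
      using that P_fin by blast
    show "\<forall>i\<in>I. \<forall>j\<in>I. i \<noteq> j \<longrightarrow> P i \<inter> P j = {}"
      using disjoint_family_on_mono[OF that P(2)] by (simp add: disjoint_family_on_def)
  qed
  define \<I> where "\<I> = {I. I \<subseteq> {1..n} \<and> (\<Sum>x\<in>(\<Union>i\<in>I. P i). \<pi> x) \<ge> \<alpha> / 2}"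
  let ?b = "occupation_bound \<Omega> K P (c' (\<alpha> / 2))"
  let ?e = "\<lambda>t i. exp (- real_of_int
    \<lfloor>c' (\<alpha> / 2) * real t / (exp 1 * real (mixing_time (P i) (trace_kernel \<Omega> K (P i))))\<rfloor>)"
  let ?q = "\<lambda>T t I z. chain_prob \<Omega> K z (\<lambda>\<omega>. \<forall>i\<in>I. occupation_time (P i) T \<omega> < t)"
  have fin_\<I>: "finite \<I>"
    by (rule finite_subset[of _ "Pow {1..n}"]) (auto simp: \<I>_def)
  \<comment> \<open>The full index set has mass 1, so \<open>Max\<close> is taken over a nonempty
    family.\<close>
  have "{1..n} \<in> \<I>"
    unfolding \<I>_def mem_Collect_eq P(1) using sum_stationary assms(6) by simp
  then have ne_\<I>: "\<I> \<noteq> {}"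
    by blast
  have bound_eq: "?b T t I = Max (?q T t I ` \<Omega>) + (\<Sum>i\<in>I. ?e t i)" for T t I
    by (simp add: occupation_bound_def)
  have Max_less: "Max (?b T t ` \<I>) < 1 / 4 \<longleftrightarrow> (\<forall>I\<in>\<I>. ?b T t I < 1 / 4)" for T t
    using fin_\<I> ne_\<I> by (subst Max_less_iff) simp_all
  have Min_Max_less: "Min ((\<lambda>t. Max (?b T t ` \<I>)) ` {0<..<T}) < 1 / 4 \<longleftrightarrow>
      (\<exists>t\<in>{0<..<T}. \<forall>I\<in>\<I>. ?b T t I < 1 / 4)" if "{0<..<T} \<noteq> {}" for T
    using that unfolding Max_less[symmetric] by (subst Min_less_iff) simp_all

  \<comment> \<open>Each of the two summands of the bound gets 1/8. The choice of \<open>t\<close>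
    puts every exponential below \<open>1 / (8 * n)\<close>; then \<open>T\<close> is taken so large
    that each part fails to receive \<open>t\<close> visits with probability below 1/8, from every
    start.\<close>
  have "\<exists>T. {0<..<T} \<noteq> {} \<and> (\<exists>t\<in>{0<..<T}. \<forall>I\<in>\<I>. ?b T t I < 1 / 4)"
  proof -
    have n: "n > 0"
      using P(1) V_nonempty by (cases n) auto
    have "(\<lambda>t. ?e t i) \<longlonglongrightarrow> 0" if i: "i \<in> {1..n}" for i
    proof -
      \<comment> \<open>Positivity of the mixing time is essential: division by 0 yields 0, and the
        exponential would be constantly 1.\<close>
      interpret Q: lazy_reversible "P i" "trace_kernel \<Omega> K (P i)"
          "\<lambda>x. if x \<in> P i then \<pi> x / (\<Sum>y\<in>P i. \<pi> y) else 0"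
        using lazy_reversible_trace[OF P_sub[OF i] P_ne[OF i]] by unfold_locales
      have "0 < c' (\<alpha> / 2)"
        using assms(1)[OF \<beta>(1,2)] by (simp add: mixing_hitting_constants_def \<beta>_def)
      then show ?thesis
        using floor_exp_tendsto_0[of "c' (\<alpha> / 2) /
            (exp 1 * real (mixing_time (P i) (trace_kernel \<Omega> K (P i))))"]
          Q.mixing_time_pos[OF assms(1)] by simp
    qed
    then have "\<forall>\<^sub>F t in sequentially. ?e t i < 1 / (8 * real n)" if "i \<in> {1..n}" for i
      using that n by (intro order_tendstoD(2)) auto
    then have "\<forall>\<^sub>F t in sequentially. (\<forall>i\<in>{1..n}. ?e t i < 1 / (8 * real n)) \<and> 0 < t"
      by (intro eventually_conj eventually_ball_finite eventually_gt_at_top) auto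
    then obtain t where t: "\<And>i. i \<in> {1..n} \<Longrightarrow> ?e t i < 1 / (8 * real n)" "0 < t"
      using eventually_happens'[OF sequentially_bot] by blast
    have "\<forall>\<^sub>F T in sequentially. chain_prob \<Omega> K z (\<lambda>\<omega>. occupation_time (P i) T \<omega> < t) < 1 / 8"
      if "i \<in> {1..n}" "z \<in> \<Omega>" for i z
      using chain_prob_occupation_tendsto_0[OF P_sub[OF that(1)] P_ne[OF that(1)] that(2)]
      by (rule order_tendstoD(2)) simp
    then have "\<forall>\<^sub>F T in sequentially. (\<forall>i\<in>{1..n}. \<forall>z\<in>\<Omega>.
        chain_prob \<Omega> K z (\<lambda>\<omega>. occupation_time (P i) T \<omega> < t) < 1 / 8) \<and> t < T"
      using finite_V
      by (intro eventually_conj eventually_ball_finite eventually_gt_at_top ballI) auto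
    then obtain T where T: "\<And>i z. i \<in> {1..n} \<Longrightarrow> z \<in> \<Omega> \<Longrightarrow>
        chain_prob \<Omega> K z (\<lambda>\<omega>. occupation_time (P i) T \<omega> < t) < 1 / 8" "t < T"
      using eventually_happens'[OF sequentially_bot] by blast
    have "?b T t I < 1 / 4" if I: "I \<in> \<I>" for I
    proof -
      \<comment> \<open>Since \<open>\<alpha>/2\<close> is positive, \<open>I\<close> contains some
        \<open>i\<close>; the joint event over \<open>I\<close> is contained in the event for this
        part alone.\<close>
      have "I \<noteq> {}"
        using I \<beta> by (auto simp: \<I>_def)
      moreover have "I \<subseteq> {1..n}"
        using I by (simp add: \<I>_def)
      ultimately obtain i where i: "i \<in> I" "i \<in> {1..n}"
        by blast
      have "?q T t I z < 1 / 8" if "z \<in> \<Omega>" for z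
      proof -
        have "?q T t I z \<le> chain_prob \<Omega> K z (\<lambda>\<omega>. occupation_time (P i) T \<omega> < t)"
          using i by (intro chain_prob_mono that pred_occupation_less) auto
        then show ?thesis
          using T(1)[OF i(2) that] by simp
      qed
      then have "Max (?q T t I ` \<Omega>) < 1 / 8"
        using finite_V V_nonempty by (subst Max_less_iff) auto
      moreover have "(\<Sum>i\<in>I. ?e t i) \<le> (\<Sum>i\<in>{1..n}. ?e t i)"
        using I by (intro sum_mono2) (auto simp: \<I>_def)
      moreover have "(\<Sum>i\<in>{1..n}. ?e t i) \<le> (\<Sum>i\<in>{1..n}. 1 / (8 * real n))"
        using t(1) by (intro sum_mono less_imp_le)
      moreover have "(\<Sum>i\<in>{1..n}. 1 / (8 * real n)) = 1 / 8"
        using n by simp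
      ultimately show ?thesis
        unfolding bound_eq by linarith
    qed
    moreover have "t \<in> {0<..<T}"
      using t(2) T(2) by simp
    ultimately show ?thesis
      by blast
  qed
  then have "\<exists>T. {0<..<T} \<noteq> {} \<and> Min ((\<lambda>t. Max (?b T t ` \<I>)) ` {0<..<T}) < 1 / 4"
    using Min_Max_less by metis
  then have "{0<..<T_prime \<Omega> K \<pi> n P \<alpha> (c' (\<alpha> / 2))} \<noteq> {} \<and>
      Min ((\<lambda>t. Max (?b (T_prime \<Omega> K \<pi> n P \<alpha> (c' (\<alpha> / 2))) t ` \<I>)) `
        {0<..<T_prime \<Omega> K \<pi> n P \<alpha> (c' (\<alpha> / 2))}) < 1 / 4"
    unfolding T_prime_def \<I>_def by (rule LeastI_ex)
  then obtain t where t: "t \<in> {0<..<T_prime \<Omega> K \<pi> n P \<alpha> (c' (\<alpha> / 2))}"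
    and b: "\<And>I. I \<in> \<I> \<Longrightarrow> ?b (T_prime \<Omega> K \<pi> n P \<alpha> (c' (\<alpha> / 2))) t I < 1 / 4"
    using Min_Max_less by metis
  define T where "T = T_prime \<Omega> K \<pi> n P \<alpha> (c' (\<alpha> / 2))"
  note t = t[folded T_def] and b = b[folded T_def]

  have "survival \<Omega> K A (Suc T) z \<le> 1 / 4"
    if A: "A \<subseteq> \<Omega>" "\<alpha> \<le> (\<Sum>x\<in>A. \<pi> x)" and z: "z \<in> \<Omega>" for A z
  proof -
    define I where "I = {i \<in> {1..n}. \<beta> * (\<Sum>x\<in>P i. \<pi> x) \<le> (\<Sum>x\<in>A \<inter> P i. \<pi> x)}"
    have I: "I \<subseteq> {1..n}" "finite I"
      by (auto simp: I_def)
    have mass_nonneg: "0 \<le> (\<Sum>x\<in>P i. \<pi> x)" if "i \<in> {1..n}" for i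
      using P_sub[OF that] stationary_nonneg by (intro sum_nonneg) auto
    have "(\<Sum>x\<in>A. \<pi> x) = (\<Sum>x\<in>(\<Union>i\<in>{1..n}. A \<inter> P i). \<pi> x)"
      using A(1) P(1) by (intro sum.cong) auto
    also have "\<dots> = (\<Sum>i\<in>{1..n}. \<Sum>x\<in>A \<inter> P i. \<pi> x)"
      using finite_subset[OF A(1) finite_V] P(2)
      by (intro sum.UNION_disjoint) (auto simp: disjoint_family_on_def)
    \<comment> \<open>A part outside \<open>I\<close> contributes at most \<open>\<beta>\<close>
      times its mass, hence all of them together at most \<open>\<beta>\<close>. As \<open>A\<close>
      has mass at least \<open>2 * \<beta>\<close>, the parts in \<open>I\<close> have total mass at
      least \<open>\<beta>\<close>.\<close>
    also have "\<dots> \<le> (\<Sum>i\<in>{1..n}. (if i \<in> I then \<Sum>x\<in>P i. \<pi> x else 0) + \<beta> * (\<Sum>x\<in>P i. \<pi> x))"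
    proof (rule sum_mono)
      fix i assume i: "i \<in> {1..n}"
      have "(\<Sum>x\<in>A \<inter> P i. \<pi> x) \<le> (\<Sum>x\<in>P i. \<pi> x)"
        using P_sub[OF i] stationary_nonneg finite_V
        by (intro sum_mono2) (auto intro: finite_subset)
      then show "(\<Sum>x\<in>A \<inter> P i. \<pi> x) \<le>
          (if i \<in> I then \<Sum>x\<in>P i. \<pi> x else 0) + \<beta> * (\<Sum>x\<in>P i. \<pi> x)"
        using i mass_nonneg[OF i] \<beta>(1) by (auto simp: I_def intro: add_increasing2)
    qed
    also have "\<dots> = (\<Sum>i\<in>I. \<Sum>x\<in>P i. \<pi> x) + \<beta> * (\<Sum>i\<in>{1..n}. \<Sum>x\<in>P i. \<pi> x)"
      using I(1) by (simp add: sum.distrib sum_distrib_left sum.inter_restrict[symmetric] Int_absorb1)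
    also have "\<dots> = (\<Sum>x\<in>(\<Union>i\<in>I. P i). \<pi> x) + \<beta>"
      using mass_UN[OF I(1)] mass_UN[of "{1..n}"] P(1) sum_stationary by simp
    finally have "I \<in> \<I>"
      using A(2) \<beta> I by (simp add: \<I>_def)
    have "survival \<Omega> K A (Suc T) z \<le> ?q T t I z + (\<Sum>i\<in>I. visit_survival (P i) A t z)"
      using I(1) by (intro survival_le_occupation z I(2) P_sub P_ne) blast+
    also have "?q T t I z \<le> Max (?q T t I ` \<Omega>)"
      using z finite_V by (intro Max_ge) auto
    also have "(\<Sum>i\<in>I. visit_survival (P i) A t z) \<le> (\<Sum>i\<in>I. ?e t i)"
    proof (rule sum_mono)
      fix i assume "i \<in> I"
      then have i: "i \<in> {1..n}" "\<beta> * (\<Sum>x\<in>P i. \<pi> x) \<le> (\<Sum>x\<in>A \<inter> P i. \<pi> x)"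
        by (auto simp: I_def)
      have "visit_survival (P i) A t z \<le> exp (- real_of_int
          \<lfloor>c' \<beta> * real t / (exp 1 * real (mixing_time (P i) (trace_kernel \<Omega> K (P i))))\<rfloor>)"
        using t by (intro visit_survival_le_exp[OF assms(1)] P_sub P_ne i z \<beta>) auto
      then show "visit_survival (P i) A t z \<le> ?e t i"
        by (simp add: \<beta>_def)
    qed
    also have "Max (?q T t I ` \<Omega>) + (\<Sum>i\<in>I. ?e t i) = ?b T t I"
      by (rule bound_eq[symmetric])
    also have "\<dots> \<le> 1 / 4"
      using b[OF \<open>I \<in> \<I>\<close>] by simp
    finally show ?thesis
      by simp
  qed
  moreover have "\<alpha> \<le> 1" and "T > 0"
    using assms(6) t by auto
  ultimately show ?thesis
    unfolding T_def[symmetric] using assms(1)[OF assms(5,6)] assms(3)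
    by (intro mixing_time_le_of_survival)
qed

end
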